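(* Let $\mathcal R\subset\mathbb R^J$ be finite. There is $M_0$ such that for every constant $M\ge M_0$ ("big-$M$" constant), the offline min-max regret elicitation problem $$(\mathrm{QP}_r)\qquad\min_{\iota\in\mathcal C^K}\ \max_{s\in\mathcal S_\Gamma(\iota)}\ \min_{x\in\mathcal R}\ \max_{u\in\mathcal U_\Gamma(\iota,s)}\Big\{\max_{x'\in\mathcal R}u^\top x'-u^\top x\Big\}$$ is equivalent to the following mixed-binary linear program: minimize $\tau$ over $\tau\in\mathbb R$; $v^\kappa,w^\kappa\in\{0,1\}^I$ ($\kappa\in\mathcal K$); $x^s\in\mathcal R$ ($s\in\{-1,1\}^K$); $\alpha^{(x',s)}\in\mathbb R_-^K$, $\beta^{(x',s)}\in\mathbb R_-^N$, $\mu^{(x',s)}\in\mathbb R_+$ ($s\in\{-1,1\}^K$, $x'\in\mathcal R$); $\overline v^{(x',s)\kappa},\overline w^{(x',s)\kappa}\in\mathbb R_-^I$ ($s\in\{-1,1\}^K$, $x'\in\mathcal R$, $\kappa\in\mathcal K$), subject to (1) for all $s\in\{-1,1\}^K$, $x'\in\mathcal R$: $\tau\ge b^\top\beta^{(x',s)}+\Gamma\mu^{(x',s)}$; $\ \sum_{i=1}^I x^i\sum_{\kappa\in\mathcal K}s_\kappa\big(\overline v_i^{(x',s)\kappa}-\overline w_i^{(x',s)\kappa}\big)+B^\top\beta^{(x',s)}=x'-x^s$; $\ \alpha^{(x',s)}+\mu^{(x',s)}\mathbf 1\ge 0$; (2) for all $\kappa\in\mathcal K$: $\mathbf 1^\top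 v^\kappa=1$, $\mathbf 1^\top w^\kappa=1$, and $1-w_i^\kappa\ge\sum_{i'\ge i}v_{i'}^\kappa$ for all $i\in\{1,\dots,I\}$; (3) for all $s\in\{-1,1\}^K$, $x'\in\mathcal R$, $\kappa\in\mathcal K$: $\overline v^{(x',s)\kappa}\ge-Mv^\kappa$, $\overline v^{(x',s)\kappa}\ge\alpha_\kappa^{(x',s)}\mathbf 1$, $\overline v^{(x',s)\kappa}\le\alpha_\kappa^{(x',s)}\mathbf 1+M(\mathbf 1-v^\kappa)$, and $\overline w^{(x',s)\kappa}\ge-Mw^\kappa$, $\overline w^{(x',s)\kappa}\ge\alpha_\kappa^{(x',s)}\mathbf 1$, $\overline w^{(x',s)\kappa}\le\alpha_\kappa^{(x',s)}\mathbf 1+M(\mathbf 1-w^\kappa)$. In particular, given an optimal solution of this mixed-binary linear program, an optimal set of queries for $(\mathrm{QP}_r)$ is given by $\iota_1^\kappa=\sum_{i=1}^I i\cdot\mathbb I(v_i^\kappa=1)$ and $\iota_2^\kappa=\sum_{i=1}^I i\cdot\mathbb I(w_i^\kappa=1)$, $\kappa\in\mathcal K$.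
   Context: Data: integers $I\ge 2$, $J,K\ge 1$; items $x^1,\dots,x^I\in\mathbb R^J$; a recommendation set $\mathcal R\subset\mathbb R^J$; $\mathcal U^0=\{u\in\mathbb R^J:Bu\ge b\}$ with $B\in\mathbb R^{N\times J}$, $b\in\mathbb R^N$, non-empty, full-dimensional and bounded; $\Gamma\ge 0$. Notation: $\mathcal K=\{1,\dots,K\}$; $\mathcal C=\{(i,i'):1\le i<i'\le I\}$; $\iota=(\iota^\kappa)_{\kappa\in\mathcal K}\in\mathcal C^K$, $\iota^\kappa=(\iota^\kappa_1,\iota^\kappa_2)$; $\mathcal E_\Gamma=\{\epsilon\in\mathbb R_+^K:\sum_\kappa\epsilon_\kappa\le\Gamma\}$; $\mathbf 1$ is the all-ones vector; vector inequalities are componentwise; $\mathbb I(E)=1$ if $E$ is true, $0$ otherwise. For $s\in\{-1,0,1\}^K$ and with $d^\kappa=x^{\iota_1^\kappa}-x^{\iota_2^\kappa}$, $$\mathcal U_\Gamma(\iota,s)=\Big\{u\in\mathcal U^0:\exists\epsilon\in\mathcal E_\Gamma\text{ with }u^\top d^\kappa>-\epsilon_\kappa\ \forall\kappa:s_\kappa=1;\ |u^\top d^\kappa|\le\epsilon_\kappa\ \forall\kappa:s_\kappa=0;\ u^\top d^\kappa<\epsilon_\kappa\ \forall\kappa:s_\kappa=-1\Big\},$$ and $\mathcal S_\Gamma(\iota)=\{s\in\{-1,0,1\}^K:\mathcal U_\Gamma(\iota,s)\neq\emptyset\}$. Conventions: $\max,\min$ denote suprema/infima in the extended reals. "Equivalent"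 means: same optimal value and same set of optimal queries, where $\iota\in\mathcal C^K$ is optimal if the optimal value with the queries fixed to $\iota$ equals the overall optimal value; in the mixed-binary linear program, $(v,w)$ encodes $\iota$ by the displayed formulas. *)

theory Defs
  imports "HOL-Analysis.Analysis"
begin

text \<open>
  The dimensions \<open>J\<close>, \<open>K\<close> and \<open>N\<close> are the cardinalities of the index types \<open>'j\<close>, \<open>'k\<close> and \<open>'n\<close>.
  Items are numbered by naturals, because the order on item numbers and their values matter; item
  families and the vectors indexed by items are functions on \<^typ>\<open>nat\<close> of which only the entries at
  \<open>1, \<dots>, I\<close> are ever used.
\<close>

definition initial_set :: "real^'j^'n \<Rightarrow> real^'n \<Rightarrow> (real^'j) set" where
  "initial_set B b = {u. \<forall>n. (B *v u) $ n \<ge> b $ n}"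

definition error_set :: "real \<Rightarrow> (real^'k) set" where
  "error_set \<Gamma> = {\<epsilon>. (\<forall>\<kappa>. \<epsilon> $ \<kappa> \<ge> 0) \<and> (\<Sum>\<kappa>\<in>UNIV. \<epsilon> $ \<kappa>) \<le> \<Gamma>}"

definition comparisons :: "nat \<Rightarrow> (nat \<times> nat) set" where
  "comparisons I = {(i, i'). 1 \<le> i \<and> i < i' \<and> i' \<le> I}"

definition query_sets :: "nat \<Rightarrow> ((nat \<times> nat)^'k) set" where
  "query_sets I = {\<iota>. \<forall>\<kappa>. \<iota> $ \<kappa> \<in> comparisons I}"

definition query_diff :: "(nat \<Rightarrow> real^'j) \<Rightarrow> (nat \<times> nat)^'k \<Rightarrow> 'k \<Rightarrow> real^'j" where
  "query_diff x \<iota> \<kappa> = x (fst (\<iota> $ \<kappa>)) - x (snd (\<iota> $ \<kappa>))"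

definition response_set ::
  "(nat \<Rightarrow> real^'j) \<Rightarrow> real^'j^'n \<Rightarrow> real^'n \<Rightarrow> real \<Rightarrow> (nat \<times> nat)^'k \<Rightarrow> int^'k \<Rightarrow> (real^'j) set" where
  "response_set x B b \<Gamma> \<iota> s = {u \<in> initial_set B b. \<exists>\<epsilon>\<in>error_set \<Gamma>.
     (\<forall>\<kappa>. s $ \<kappa> = 1 \<longrightarrow> u \<bullet> query_diff x \<iota> \<kappa> > - (\<epsilon> $ \<kappa>)) \<and>
     (\<forall>\<kappa>. s $ \<kappa> = 0 \<longrightarrow> \<bar>u \<bullet> query_diff x \<iota> \<kappa>\<bar> \<le> \<epsilon> $ \<kappa>) \<and>
     (\<forall>\<kappa>. s $ \<kappa> = -1 \<longrightarrow> u \<bullet> query_diff x \<iota> \<kappa> < \<epsilon> $ \<kappa>)}"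

definition responses ::
  "(nat \<Rightarrow> real^'j) \<Rightarrow> real^'j^'n \<Rightarrow> real^'n \<Rightarrow> real \<Rightarrow> (nat \<times> nat)^'k \<Rightarrow> (int^'k) set" where
  "responses x B b \<Gamma> \<iota> =
     {s. (\<forall>\<kappa>. s $ \<kappa> \<in> {-1, 0, 1}) \<and> response_set x B b \<Gamma> \<iota> s \<noteq> {}}"

definition qp_value_at ::
  "(nat \<Rightarrow> real^'j) \<Rightarrow> (real^'j) set \<Rightarrow> real^'j^'n \<Rightarrow> real^'n \<Rightarrow> real \<Rightarrow> (nat \<times> nat)^'k \<Rightarrow> ereal" where
  "qp_value_at x R B b \<Gamma> \<iota> =
     (SUP s\<in>responses x B b \<Gamma> \<iota>. INF y\<in>R. SUP u\<in>response_set x B b \<Gamma> \<iota> s.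
        (SUP x'\<in>R. ereal (u \<bullet> x')) - ereal (u \<bullet> y))"

text \<open>The type argument fixes the number of queries, which does not occur in the other arguments.\<close>

definition qp_value ::
  "'k::finite itself \<Rightarrow> nat \<Rightarrow> (nat \<Rightarrow> real^'j) \<Rightarrow> (real^'j) set \<Rightarrow> real^'j^'n \<Rightarrow> real^'n \<Rightarrow> real \<Rightarrow> ereal" where
  "qp_value TYPE('k) I x R B b \<Gamma> =
     (INF \<iota>\<in>(query_sets I :: ((nat \<times> nat)^'k) set). qp_value_at x R B b \<Gamma> \<iota>)"

definition qp_optimal_queries ::
  "nat \<Rightarrow> (nat \<Rightarrow> real^'j) \<Rightarrow> (real^'j) set \<Rightarrow> real^'j^'n \<Rightarrow> real^'n \<Rightarrow> real
     \<Rightarrow> ((nat \<times> nat)^'k) set" where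
  "qp_optimal_queries I x R B b \<Gamma> =
     {\<iota> \<in> query_sets I. qp_value_at x R B b \<Gamma> \<iota> = qp_value TYPE('k) I x R B b \<Gamma>}"

text \<open>
  A point of the mixed-binary linear program. Families indexed by \<open>(x', s)\<close> are curried; their
  values outside \<open>R\<close> and \<open>{-1, 1}\<^sup>K\<close> are irrelevant.
\<close>

record ('j, 'k, 'n) milp_point =
  tau :: real
  vsel :: "'k \<Rightarrow> nat \<Rightarrow> real"
  wsel :: "'k \<Rightarrow> nat \<Rightarrow> real"
  rec :: "int^'k \<Rightarrow> real^'j"
  alpha :: "real^'j \<Rightarrow> int^'k \<Rightarrow> real^'k"
  beta :: "real^'j \<Rightarrow> int^'k \<Rightarrow> real^'n"
  mu :: "real^'j \<Rightarrow> int^'k \<Rightarrow> real"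
  vbar :: "real^'j \<Rightarrow> int^'k \<Rightarrow> 'k \<Rightarrow> nat \<Rightarrow> real"
  wbar :: "real^'j \<Rightarrow> int^'k \<Rightarrow> 'k \<Rightarrow> nat \<Rightarrow> real"

definition strict_responses :: "(int^'k) set" where
  "strict_responses = {s. \<forall>\<kappa>. s $ \<kappa> \<in> {-1, 1}}"

definition milp_domain ::
  "nat \<Rightarrow> (real^'j) set \<Rightarrow> ('j::finite, 'k::finite, 'n::finite) milp_point \<Rightarrow> bool" where
  "milp_domain I R p \<longleftrightarrow>
     (\<forall>\<kappa>. \<forall>i\<in>{1..I}. vsel p \<kappa> i \<in> {0, 1} \<and> wsel p \<kappa> i \<in> {0, 1}) \<and>
     (\<forall>s\<in>strict_responses. rec p s \<in> R) \<and>
     (\<forall>s\<in>strict_responses. \<forall>x'\<in>R.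
        (\<forall>\<kappa>. alpha p x' s $ \<kappa> \<le> 0) \<and>
        (\<forall>n. beta p x' s $ n \<le> 0) \<and>
        mu p x' s \<ge> 0 \<and>
        (\<forall>\<kappa>. \<forall>i\<in>{1..I}. vbar p x' s \<kappa> i \<le> 0 \<and> wbar p x' s \<kappa> i \<le> 0))"

definition milp_dual_constraints ::
  "nat \<Rightarrow> (nat \<Rightarrow> real^'j) \<Rightarrow> (real^'j) set \<Rightarrow> real^'j^'n \<Rightarrow> real^'n \<Rightarrow> real
     \<Rightarrow> ('j::finite, 'k::finite, 'n::finite) milp_point \<Rightarrow> bool" where
  "milp_dual_constraints I x R B b \<Gamma> p \<longleftrightarrow>
     (\<forall>s\<in>strict_responses. \<forall>x'\<in>R.
        tau p \<ge> b \<bullet> beta p x' s + \<Gamma> * mu p x' s \<and>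
        (\<Sum>i=1..I. (\<Sum>\<kappa>\<in>UNIV. real_of_int (s $ \<kappa>) * (vbar p x' s \<kappa> i - wbar p x' s \<kappa> i)) *\<^sub>R x i)
          + transpose B *v beta p x' s = x' - rec p s \<and>
        (\<forall>\<kappa>. alpha p x' s $ \<kappa> + mu p x' s \<ge> 0))"

definition milp_query_constraints ::
  "nat \<Rightarrow> ('j::finite, 'k::finite, 'n::finite) milp_point \<Rightarrow> bool" where
  "milp_query_constraints I p \<longleftrightarrow>
     (\<forall>\<kappa>. (\<Sum>i=1..I. vsel p \<kappa> i) = 1 \<and> (\<Sum>i=1..I. wsel p \<kappa> i) = 1 \<and>
        (\<forall>i\<in>{1..I}. 1 - wsel p \<kappa> i \<ge> (\<Sum>i'=i..I. vsel p \<kappa> i')))"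

definition milp_linking_constraints ::
  "nat \<Rightarrow> (real^'j) set \<Rightarrow> real \<Rightarrow> ('j::finite, 'k::finite, 'n::finite) milp_point \<Rightarrow> bool" where
  "milp_linking_constraints I R M p \<longleftrightarrow>
     (\<forall>s\<in>strict_responses. \<forall>x'\<in>R. \<forall>\<kappa>. \<forall>i\<in>{1..I}.
        vbar p x' s \<kappa> i \<ge> - M * vsel p \<kappa> i \<and>
        vbar p x' s \<kappa> i \<ge> alpha p x' s $ \<kappa> \<and>
        vbar p x' s \<kappa> i \<le> alpha p x' s $ \<kappa> + M * (1 - vsel p \<kappa> i) \<and>
        wbar p x' s \<kappa> i \<ge> - M * wsel p \<kappa> i \<and>
        wbar p x' s \<kappa> i \<ge> alpha p x' s $ \<kappa> \<and>
        wbar p x' s \<kappa> i \<le> alpha p x' s $ \<kappa> + M * (1 - wsel p \<kappa> i))"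

definition milp_feasible ::
  "nat \<Rightarrow> (nat \<Rightarrow> real^'j) \<Rightarrow> (real^'j) set \<Rightarrow> real^'j^'n \<Rightarrow> real^'n \<Rightarrow> real \<Rightarrow> real
     \<Rightarrow> ('j::finite, 'k::finite, 'n::finite) milp_point set" where
  "milp_feasible I x R B b \<Gamma> M =
     {p. milp_domain I R p \<and> milp_dual_constraints I x R B b \<Gamma> p \<and>
         milp_query_constraints I p \<and> milp_linking_constraints I R M p}"

definition encoded_queries ::
  "nat \<Rightarrow> ('j::finite, 'k::finite, 'n::finite) milp_point \<Rightarrow> (nat \<times> nat)^'k" where
  "encoded_queries I p =
     (\<chi> \<kappa>. (\<Sum>i=1..I. i * of_bool (vsel p \<kappa> i = 1), \<Sum>i=1..I. i * of_bool (wsel p \<kappa> i = 1)))"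

definition milp_value ::
  "'k::finite itself \<Rightarrow> nat \<Rightarrow> (nat \<Rightarrow> real^'j) \<Rightarrow> (real^'j) set \<Rightarrow> real^'j^'n \<Rightarrow> real^'n \<Rightarrow> real \<Rightarrow> real
     \<Rightarrow> ereal" where
  "milp_value TYPE('k) I x R B b \<Gamma> M =
     (INF p\<in>(milp_feasible I x R B b \<Gamma> M :: ('j, 'k, 'n) milp_point set). ereal (tau p))"

definition milp_value_at ::
  "nat \<Rightarrow> (nat \<Rightarrow> real^'j) \<Rightarrow> (real^'j) set \<Rightarrow> real^'j^'n \<Rightarrow> real^'n \<Rightarrow> real \<Rightarrow> real
     \<Rightarrow> (nat \<times> nat)^'k \<Rightarrow> ereal" where
  "milp_value_at I x R B b \<Gamma> M \<iota> =
     (INF p\<in>{p \<in> milp_feasible I x R B b \<Gamma> M. encoded_queries I p = \<iota>}. ereal (tau p))"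

definition milp_optimal_queries ::
  "nat \<Rightarrow> (nat \<Rightarrow> real^'j) \<Rightarrow> (real^'j) set \<Rightarrow> real^'j^'n \<Rightarrow> real^'n \<Rightarrow> real \<Rightarrow> real
     \<Rightarrow> ((nat \<times> nat)^'k) set" where
  "milp_optimal_queries I x R B b \<Gamma> M =
     {\<iota> \<in> query_sets I. milp_value_at I x R B b \<Gamma> M \<iota> = milp_value TYPE('k) I x R B b \<Gamma> M}"

definition milp_optimal_solutions ::
  "nat \<Rightarrow> (nat \<Rightarrow> real^'j) \<Rightarrow> (real^'j) set \<Rightarrow> real^'j^'n \<Rightarrow> real^'n \<Rightarrow> real \<Rightarrow> real
     \<Rightarrow> ('j::finite, 'k::finite, 'n::finite) milp_point set" where
  "milp_optimal_solutions I x R B b \<Gamma> M =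
     {p \<in> milp_feasible I x R B b \<Gamma> M.
        \<forall>q\<in>(milp_feasible I x R B b \<Gamma> M :: ('j, 'k, 'n) milp_point set). tau p \<le> tau q}"

end

theory Submission
  imports Defs
begin

text \<open>
  Replacing strict inequalities by weak ones turns each answer pattern \<open>s \<in> {-1, 1}\<^sup>K\<close> into a
  polytope. Every response set lies in such a polytope, since an indifferent answer also satisfies
  the weak inequality of a positive one. Conversely a nonempty polytope lies in the closure of some
  nonempty response set: that of \<open>s\<close> itself, or, if that one is empty, that of the pattern of signs
  attained on the polytope, which then do not conflict between points. So for fixed queries the
  worst case may be taken over polytopes, and a bound \<open>\<tau>\<close> on the regret over a polytope, empty or
  not, is certified by a dual point. The linking constraints force the products of \<open>\<alpha>\<close> with the
  binary variables, and \<open>M\<close> only has to dominate the finitely many \<open>\<alpha>\<close> of chosen dual points.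
\<close>

section \<open>Farkas' lemma and duality for linear programs with an error budget\<close>

text \<open>A finitely generated convex cone is a polyhedron, hence closed, so a point outside it
  can be strictly separated from it. The separating functional is then nonnegative on the generators
  but negative at \<open>c\<close>.\<close>

lemma farkas:
  fixes S :: "'a::euclidean_space set"
  assumes "finite S"
    and c: "\<And>z. (\<And>a. a \<in> S \<Longrightarrow> 0 \<le> a \<bullet> z) \<Longrightarrow> 0 \<le> c \<bullet> z"
  shows "c \<in> convex_cone hull S"
proof (rule ccontr)
  assume "c \<notin> convex_cone hull S"
  moreover have "closed (convex_cone hull S)"
    using assms(1) by (simp add: polyhedron_convex_cone_hull polyhedron_imp_closed)
  ultimately obtain a r where ac: "a \<bullet> c < r" and ar: "\<And>z. z \<in> convex_cone hull S \<Longrightarrow> r < a \<bullet> z"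
    using separating_hyperplane_closed_point[OF convex_convex_cone_hull] by metis
  have r: "r < 0"
    using ar[OF convex_cone_hull_contains_0] by simp
  have "0 \<le> z \<bullet> a" if z: "z \<in> S" for z
  proof (rule ccontr)
    assume "\<not> 0 \<le> z \<bullet> a"
    then have neg: "a \<bullet> z < 0"
      by (simp add: inner_commute)
    \<comment> \<open>This factor scales \<open>z\<close> to a point of the cone where the
      functional takes exactly the value \<open>r\<close>, which the strict separation
      forbids.\<close>
    then have "0 \<le> r / (a \<bullet> z)"
      using r by (simp add: divide_nonpos_neg)
    then have "r < a \<bullet> ((r / (a \<bullet> z)) *\<^sub>R z)"
      by (intro ar convex_cone_hull_mul hull_inc z)
    then show False
      using neg by simp
  qed
  then have "0 \<le> c \<bullet> a"
    by (rule c)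
  then show False
    using ac r by (simp add: inner_commute)
qed

text \<open>Such a \<open>z\<close> is a recession direction: a whole ray along it stays in the
  initial set, which boundedness allows only for the zero vector.\<close>

lemma initial_set_recession_trivial:
  fixes B :: "real^'j^'n"
  assumes "initial_set B b \<noteq> {}" "bounded (initial_set B b)" "\<And>n. 0 \<le> (B *v z) $ n"
  shows "z = 0"
proof (rule ccontr)
  assume z: "z \<noteq> 0"
  obtain u where u: "u \<in> initial_set B b"
    using assms(1) by auto
  obtain C where C: "\<And>y. y \<in> initial_set B b \<Longrightarrow> norm y \<le> C"
    using assms(2) bounded_iff by blast
  have "u + t *\<^sub>R z \<in> initial_set B b" if "0 \<le> t" for t
    using u assms(3) that
    by (auto simp: initial_set_def matrix_vector_right_distrib matrix_vector_mult_scaleR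
             intro: add_increasing2)
  then have le: "norm (u + t *\<^sub>R z) \<le> C" if "0 \<le> t" for t
    using C that by blast
  \<comment> \<open>Chosen so that \<open>t *\<^sub>R z\<close> has norm
    \<open>C + norm u + 1\<close>, one more than the triangle inequality permits.\<close>
  define t where "t = (C + norm u + 1) / norm z"
  have "0 \<le> C"
    using C[OF u] norm_ge_zero order_trans by blast
  then have t: "0 \<le> t"
    by (simp add: t_def)
  have "norm (t *\<^sub>R z) \<le> norm (u + t *\<^sub>R z) + norm u"
    using norm_triangle_ineq4[of "u + t *\<^sub>R z" u] by simp
  also have "\<dots> \<le> C + norm u"
    using le[OF t] by simp
  finally show False
    using t z by (simp add: t_def)
qed

lemma inner_transpose_mult:
  fixes B :: "real^'j^'n"
  shows "u \<bullet> (transpose B *v \<beta>) = (B *v u) \<bullet> \<beta>"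
  by (metis dot_lmul_matrix inner_commute vector_transpose_matrix transpose_transpose)

text \<open>
  The primal is homogenised by an extra coordinate \<open>t\<close>, so that an infeasible primal needs no
  separate treatment: at \<open>t = 0\<close> boundedness of the initial set forces \<open>u = 0\<close>.
\<close>

lemma robust_dual_exists:
  fixes B :: "real^'j^'n" and d :: "'k::finite \<Rightarrow> real^'j"
  assumes "initial_set B b \<noteq> {}" "bounded (initial_set B b)"
    and le: "\<And>u \<epsilon>. u \<in> initial_set B b \<Longrightarrow> \<epsilon> \<in> error_set \<Gamma> \<Longrightarrow> (\<And>\<kappa>. - (\<epsilon> $ \<kappa>) \<le> u \<bullet> d \<kappa>) \<Longrightarrow> u \<bullet> c \<le> v"
  shows "\<exists>\<alpha> \<beta> \<mu>. (\<forall>\<kappa>. \<alpha> $ \<kappa> \<le> 0) \<and> (\<forall>n. \<beta> $ n \<le> 0) \<and> 0 \<le> \<mu> \<and> b \<bullet> \<beta> + \<Gamma> * \<mu> \<le> v \<and>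
    (\<Sum>\<kappa>\<in>UNIV. \<alpha> $ \<kappa> *\<^sub>R d \<kappa>) + transpose B *v \<beta> = c \<and> (\<forall>\<kappa>. 0 \<le> \<alpha> $ \<kappa> + \<mu>)"
proof -
  \<comment> \<open>The generators are the normals of the homogenised primal constraints on
    \<open>(u, \<epsilon>, t)\<close>: \<open>B *v u\<close> at least \<open>t\<close> times
    \<open>b\<close>, \<open>u \<bullet> d \<kappa> + \<epsilon> $ \<kappa> \<ge> 0\<close>,
    nonnegative errors, total error at most \<open>\<Gamma> * t\<close>, and
    \<open>t \<ge> 0\<close>.\<close>
  define S :: "((real^'j) \<times> (real^'k) \<times> real) set" where
    "S = range (\<lambda>n. (row n B, 0, - (b $ n))) \<union> range (\<lambda>\<kappa>. (d \<kappa>, axis \<kappa> 1, 0))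
       \<union> range (\<lambda>\<kappa>. (0, axis \<kappa> 1, 0)) \<union> {(0, - (\<chi> \<kappa>. 1), \<Gamma>), (0, 0, 1)}"
  \<comment> \<open>The set of data admitting a dual certificate: \<open>p\<close> enters negated
    and \<open>q\<close> perturbs the constraint linking \<alpha> and \<mu>, so the goal is
    membership of \<open>(- c, 0, v)\<close>. Showing that \<open>T\<close> is a convex cone
    containing \<open>S\<close> avoids extracting coefficients from the hull.\<close>
  define T :: "((real^'j) \<times> (real^'k) \<times> real) set" where
    "T = {(p, q, r). \<exists>\<alpha> \<beta> \<mu>. (\<forall>\<kappa>. \<alpha> $ \<kappa> \<le> 0) \<and> (\<forall>n. \<beta> $ n \<le> 0) \<and> 0 \<le> \<mu> \<and>
       b \<bullet> \<beta> + \<Gamma> * \<mu> \<le> r \<and> (\<Sum>\<kappa>\<in>UNIV. \<alpha> $ \<kappa> *\<^sub>R d \<kappa>) + transpose B *v \<beta> = - p \<and>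
       (\<forall>\<kappa>. 0 \<le> \<alpha> $ \<kappa> + \<mu> + q $ \<kappa>)}"
  have "(- c, 0, v) \<in> convex_cone hull S"
  proof (rule farkas)
    show "finite S"
      by (simp add: S_def)
  next
    fix z :: "(real^'j) \<times> (real^'k) \<times> real"
    assume z: "\<And>a. a \<in> S \<Longrightarrow> 0 \<le> a \<bullet> z"
    obtain u \<epsilon> t where z_eq: "z = (u, \<epsilon>, t)"
      by (metis prod.exhaust)
    have Bu: "b $ n * t \<le> (B *v u) $ n" for n
      using z[of "(row n B, 0, - (b $ n))"]
      by (simp add: S_def z_eq matrix_vector_mul_component row_def inner_vec_def)
    have ud: "0 \<le> u \<bullet> d \<kappa> + \<epsilon> $ \<kappa>" for \<kappa>
      using z[of "(d \<kappa>, axis \<kappa> 1, 0)"] by (simp add: S_def z_eq inner_axis inner_commute)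
    have \<epsilon>0: "0 \<le> \<epsilon> $ \<kappa>" for \<kappa>
      using z[of "(0, axis \<kappa> 1, 0)"] by (simp add: S_def z_eq inner_axis')
    have \<epsilon>\<Gamma>: "(\<Sum>\<kappa>\<in>UNIV. \<epsilon> $ \<kappa>) \<le> \<Gamma> * t"
      using z[of "(0, - (\<chi> \<kappa>. 1), \<Gamma>)"] by (simp add: S_def z_eq inner_vec_def sum_negf)
    have "0 \<le> t"
      using z[of "(0, 0, 1)"] by (simp add: S_def z_eq)
    then consider "t = 0" | "0 < t"
      by linarith
    then have "u \<bullet> c \<le> v * t"
    proof cases
      case 1
      then have "u = 0"
        using Bu by (intro initial_set_recession_trivial[OF assms(1,2)]) simp
      then show ?thesis
        by (simp add: 1)
    next
      case 2
      \<comment> \<open>Dividing by \<open>t\<close> gives a feasible point of the original primal,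
        to which the assumed bound applies.\<close>
      have "((1 / t) *\<^sub>R u) \<bullet> c \<le> v"
      proof (rule le)
        show "(1 / t) *\<^sub>R u \<in> initial_set B b"
          using Bu 2 by (simp add: initial_set_def matrix_vector_mult_scaleR pos_le_divide_eq)
        show "(1 / t) *\<^sub>R \<epsilon> \<in> error_set \<Gamma>"
          using \<epsilon>0 \<epsilon>\<Gamma> 2 by (simp add: error_set_def pos_divide_le_eq flip: sum_divide_distrib)
        fix \<kappa>
        have "0 \<le> (u \<bullet> d \<kappa> + \<epsilon> $ \<kappa>) / t"
          using ud 2 by simp
        then show "- (((1 / t) *\<^sub>R \<epsilon>) $ \<kappa>) \<le> ((1 / t) *\<^sub>R u) \<bullet> d \<kappa>"
          by (simp add: add_divide_distrib)
      qed
      then show ?thesis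
        using 2 by (simp add: pos_divide_le_eq)
    qed
    then show "0 \<le> (- c, 0, v) \<bullet> z"
      by (simp add: z_eq inner_commute)
  qed
  moreover have "convex_cone hull S \<subseteq> T"
  proof (rule hull_minimal)
    have T0: "(p, q, r) \<in> T" if "\<forall>\<kappa>. \<alpha> $ \<kappa> \<le> 0" "\<forall>n. \<beta> $ n \<le> 0" "0 \<le> \<mu>"
       "b \<bullet> \<beta> + \<Gamma> * \<mu> \<le> r" "(\<Sum>\<kappa>\<in>UNIV. \<alpha> $ \<kappa> *\<^sub>R d \<kappa>) + transpose B *v \<beta> = - p"
       "\<forall>\<kappa>. 0 \<le> \<alpha> $ \<kappa> + \<mu> + q $ \<kappa>" for p q r \<alpha> \<beta> \<mu>
      using that unfolding T_def by blast
    \<comment> \<open>Generators of the first, second and fourth kind need one unit multiplier, in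
      \<beta>, \<alpha> and \<mu> respectively, negative for \<beta> and \<alpha>. The other two are
      absorbed by the slack in the inequalities of \<open>T\<close>.\<close>
    show "S \<subseteq> T"
    proof
      fix a
      assume "a \<in> S"
      then consider n where "a = (row n B, 0, - (b $ n))" | \<kappa> where "a = (d \<kappa>, axis \<kappa> 1, 0)"
        | \<kappa> where "a = (0, axis \<kappa> 1, 0)" | "a = (0, - (\<chi> \<kappa>. 1), \<Gamma>)" | "a = (0, 0, 1)"
        unfolding S_def by blast
      then show "a \<in> T"
      proof cases
        case (1 n)
        have "transpose B *v axis n (-1) = - row n B"
          by (simp add: vec_eq_iff matrix_vector_mult_def transpose_def row_def axis_def
              if_distrib cong: if_cong)
        then show ?thesis
          unfolding 1 by (intro T0[where \<alpha>=0 and \<beta>="axis n (-1)" and \<mu>=0])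
            (simp_all add: inner_axis, simp add: axis_def)
      next
        case (2 \<kappa>)
        have "(\<Sum>i\<in>UNIV. axis \<kappa> (-1::real) $ i *\<^sub>R d i) = - d \<kappa>"
          by (simp add: axis_def if_distrib[of "\<lambda>t. t *\<^sub>R _"] cong: if_cong)
        then show ?thesis
          unfolding 2 by (intro T0[where \<alpha>="axis \<kappa> (-1)" and \<beta>=0 and \<mu>=0])
            (auto simp: axis_def)
      next
        case (3 \<kappa>)
        then show ?thesis
          by (auto intro!: T0[where \<alpha>=0 and \<beta>=0 and \<mu>=0] simp: axis_def)
      next
        case 4
        then show ?thesis
          by (auto intro!: T0[where \<alpha>=0 and \<beta>=0 and \<mu>=1])
      next
        case 5
        then show ?thesis
          by (auto intro!: T0[where \<alpha>=0 and \<beta>=0 and \<mu>=0])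
      qed
    qed
    have zero: "0 \<in> T"
      by (auto intro!: T0[where \<alpha>=0 and \<beta>=0 and \<mu>=0] simp: zero_prod_def)
    have add: "a + a' \<in> T" if T: "a \<in> T" "a' \<in> T" for a a'
    proof -
      obtain p q r p' q' r' where a_eq: "a = (p, q, r)" "a' = (p', q', r')"
        by (metis prod.exhaust)
      obtain \<alpha> \<beta> \<mu> where 1: "\<forall>\<kappa>. \<alpha> $ \<kappa> \<le> 0" "\<forall>n. \<beta> $ n \<le> 0" "0 \<le> \<mu>"
       "b \<bullet> \<beta> + \<Gamma> * \<mu> \<le> r" "(\<Sum>\<kappa>\<in>UNIV. \<alpha> $ \<kappa> *\<^sub>R d \<kappa>) + transpose B *v \<beta> = - p"
       "\<forall>\<kappa>. 0 \<le> \<alpha> $ \<kappa> + \<mu> + q $ \<kappa>"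
        using T(1) unfolding T_def a_eq by auto
      obtain \<alpha>' \<beta>' \<mu>' where 2: "\<forall>\<kappa>. \<alpha>' $ \<kappa> \<le> 0" "\<forall>n. \<beta>' $ n \<le> 0" "0 \<le> \<mu>'"
       "b \<bullet> \<beta>' + \<Gamma> * \<mu>' \<le> r'" "(\<Sum>\<kappa>\<in>UNIV. \<alpha>' $ \<kappa> *\<^sub>R d \<kappa>) + transpose B *v \<beta>' = - p'"
       "\<forall>\<kappa>. 0 \<le> \<alpha>' $ \<kappa> + \<mu>' + q' $ \<kappa>"
        using T(2) unfolding T_def a_eq by auto
      have "(p + p', q + q', r + r') \<in> T"
      proof (rule T0[where \<alpha>="\<alpha> + \<alpha>'" and \<beta>="\<beta> + \<beta>'" and \<mu>="\<mu> + \<mu>'"])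
        have "(\<Sum>\<kappa>\<in>UNIV. (\<alpha> + \<alpha>') $ \<kappa> *\<^sub>R d \<kappa>) + transpose B *v (\<beta> + \<beta>') =
            ((\<Sum>\<kappa>\<in>UNIV. \<alpha> $ \<kappa> *\<^sub>R d \<kappa>) + transpose B *v \<beta>) +
            ((\<Sum>\<kappa>\<in>UNIV. \<alpha>' $ \<kappa> *\<^sub>R d \<kappa>) + transpose B *v \<beta>')"
          by (simp add: scaleR_left_distrib sum.distrib matrix_vector_right_distrib)
        then show "(\<Sum>\<kappa>\<in>UNIV. (\<alpha> + \<alpha>') $ \<kappa> *\<^sub>R d \<kappa>) + transpose B *v (\<beta> + \<beta>') = - (p + p')"
          unfolding 1(5) 2(5) by simp
        show "\<forall>\<kappa>. (\<alpha> + \<alpha>') $ \<kappa> \<le> 0" "\<forall>n. (\<beta> + \<beta>') $ n \<le> 0"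
          using 1(1,2) 2(1,2) by (auto intro: add_nonpos_nonpos)
        show "0 \<le> \<mu> + \<mu>'"
          using 1(3) 2(3) by simp
        show "b \<bullet> (\<beta> + \<beta>') + \<Gamma> * (\<mu> + \<mu>') \<le> r + r'"
          using 1(4) 2(4) by (simp add: algebra_simps inner_add_right)
        show "\<forall>\<kappa>. 0 \<le> (\<alpha> + \<alpha>') $ \<kappa> + (\<mu> + \<mu>') + (q + q') $ \<kappa>"
        proof
          fix \<kappa>
          show "0 \<le> (\<alpha> + \<alpha>') $ \<kappa> + (\<mu> + \<mu>') + (q + q') $ \<kappa>"
            using 1(6)[rule_format, of \<kappa>] 2(6)[rule_format, of \<kappa>] by simp
        qed
      qed
      then show ?thesis
        by (simp add: a_eq)
    qed
    have scale: "k *\<^sub>R a \<in> T" if T: "a \<in> T" and k: "0 \<le> k" for a k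
    proof -
      obtain p q r where a_eq: "a = (p, q, r)"
        by (metis prod.exhaust)
      obtain \<alpha> \<beta> \<mu> where 1: "\<forall>\<kappa>. \<alpha> $ \<kappa> \<le> 0" "\<forall>n. \<beta> $ n \<le> 0" "0 \<le> \<mu>"
       "b \<bullet> \<beta> + \<Gamma> * \<mu> \<le> r" "(\<Sum>\<kappa>\<in>UNIV. \<alpha> $ \<kappa> *\<^sub>R d \<kappa>) + transpose B *v \<beta> = - p"
       "\<forall>\<kappa>. 0 \<le> \<alpha> $ \<kappa> + \<mu> + q $ \<kappa>"
        using T unfolding T_def a_eq by auto
      have "(k *\<^sub>R p, k *\<^sub>R q, k * r) \<in> T"
      proof (rule T0[where \<alpha>="k *\<^sub>R \<alpha>" and \<beta>="k *\<^sub>R \<beta>" and \<mu>="k * \<mu>"])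
        have "(\<Sum>\<kappa>\<in>UNIV. (k *\<^sub>R \<alpha>) $ \<kappa> *\<^sub>R d \<kappa>) + transpose B *v (k *\<^sub>R \<beta>) =
            k *\<^sub>R ((\<Sum>\<kappa>\<in>UNIV. \<alpha> $ \<kappa> *\<^sub>R d \<kappa>) + transpose B *v \<beta>)"
          by (simp add: scaleR_right_distrib scaleR_sum_right matrix_vector_mult_scaleR)
        then show "(\<Sum>\<kappa>\<in>UNIV. (k *\<^sub>R \<alpha>) $ \<kappa> *\<^sub>R d \<kappa>) + transpose B *v (k *\<^sub>R \<beta>) = - (k *\<^sub>R p)"
          unfolding 1(5) by simp
        show "\<forall>\<kappa>. (k *\<^sub>R \<alpha>) $ \<kappa> \<le> 0" "\<forall>n. (k *\<^sub>R \<beta>) $ n \<le> 0" "0 \<le> k * \<mu>"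
          using 1(1-3) k by (auto intro: mult_nonneg_nonpos)
        show "b \<bullet> (k *\<^sub>R \<beta>) + \<Gamma> * (k * \<mu>) \<le> k * r"
          using mult_left_mono[OF 1(4) k] by (simp add: algebra_simps)
        show "\<forall>\<kappa>. 0 \<le> (k *\<^sub>R \<alpha>) $ \<kappa> + k * \<mu> + (k *\<^sub>R q) $ \<kappa>"
        proof
          fix \<kappa>
          show "0 \<le> (k *\<^sub>R \<alpha>) $ \<kappa> + k * \<mu> + (k *\<^sub>R q) $ \<kappa>"
            using mult_nonneg_nonneg[OF k 1(6)[rule_format, of \<kappa>]] by (simp add: distrib_left)
        qed
      qed
      then show ?thesis
        by (simp add: a_eq)
    qed
    show "convex_cone T"
      unfolding convex_cone_iff using zero add scale by blast
  qed
  ultimately have "(- c, 0, v) \<in> T"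
    by blast
  then show ?thesis
    by (simp add: T_def)
qed

section \<open>Polytopes of weakly consistent utilities\<close>

text \<open>The factor \<open>s $ \<kappa>\<close> merges the inequalities for the answers 1 and -1
  into one. An entry 0 would make the condition vacuous, so the set relaxes
  \<open>response_set\<close> only for patterns in \<open>strict_responses\<close>.\<close>

definition weak_response_set ::
  "(nat \<Rightarrow> real^'j) \<Rightarrow> real^'j^'n \<Rightarrow> real^'n \<Rightarrow> real \<Rightarrow> (nat \<times> nat)^'k \<Rightarrow> int^'k \<Rightarrow> (real^'j) set" where
  "weak_response_set x B b \<Gamma> \<iota> s = {u \<in> initial_set B b. \<exists>\<epsilon>\<in>error_set \<Gamma>.
     \<forall>\<kappa>. - (\<epsilon> $ \<kappa>) \<le> u \<bullet> (real_of_int (s $ \<kappa>) *\<^sub>R query_diff x \<iota> \<kappa>)}"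

lemma strict_response_cases:
  assumes "s \<in> strict_responses"
  shows "s $ \<kappa> = 1 \<or> s $ \<kappa> = -1"
  using assms by (auto simp: strict_responses_def)

text \<open>Brings the response set of a strict pattern into the form of
  \<open>weak_response_set\<close>, the only difference being \<open><\<close> in place of
  \<open>\<le>\<close>.\<close>

lemma mem_response_set_strict_iff:
  assumes "s \<in> strict_responses"
  shows "u \<in> response_set x B b \<Gamma> \<iota> s \<longleftrightarrow> u \<in> initial_set B b \<and> (\<exists>\<epsilon>\<in>error_set \<Gamma>.
     \<forall>\<kappa>. - (\<epsilon> $ \<kappa>) < u \<bullet> (real_of_int (s $ \<kappa>) *\<^sub>R query_diff x \<iota> \<kappa>))"
proof -
  have "((s $ \<kappa> = 1 \<longrightarrow> u \<bullet> query_diff x \<iota> \<kappa> > - (\<epsilon> $ \<kappa>)) \<and>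
      (s $ \<kappa> = 0 \<longrightarrow> \<bar>u \<bullet> query_diff x \<iota> \<kappa>\<bar> \<le> \<epsilon> $ \<kappa>) \<and>
      (s $ \<kappa> = -1 \<longrightarrow> u \<bullet> query_diff x \<iota> \<kappa> < \<epsilon> $ \<kappa>)) \<longleftrightarrow>
      - (\<epsilon> $ \<kappa>) < u \<bullet> (real_of_int (s $ \<kappa>) *\<^sub>R query_diff x \<iota> \<kappa>)" for \<epsilon> :: "real^'a" and \<kappa>
    using strict_response_cases[OF assms, of \<kappa>] by auto
  then show ?thesis
    unfolding response_set_def by auto metis+
qed

text \<open>The condition for an indifferent answer bounds the comparison from both sides, so
  replacing 0 by 1 just drops the upper bound.\<close>

lemma response_set_subset_weak:
  assumes "\<And>\<kappa>. s $ \<kappa> \<in> {-1, 0, 1}"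
  shows "\<exists>s'\<in>strict_responses. response_set x B b \<Gamma> \<iota> s \<subseteq> weak_response_set x B b \<Gamma> \<iota> s'"
proof
  let ?s = "\<chi> \<kappa>. if s $ \<kappa> = -1 then -1 else (1::int)"
  show "?s \<in> strict_responses"
    by (simp add: strict_responses_def)
  show "response_set x B b \<Gamma> \<iota> s \<subseteq> weak_response_set x B b \<Gamma> \<iota> ?s"
  proof
    fix u
    assume "u \<in> response_set x B b \<Gamma> \<iota> s"
    then obtain \<epsilon> where u: "u \<in> initial_set B b" and \<epsilon>: "\<epsilon> \<in> error_set \<Gamma>"
      and 1: "\<And>\<kappa>. s $ \<kappa> = 1 \<Longrightarrow> u \<bullet> query_diff x \<iota> \<kappa> > - (\<epsilon> $ \<kappa>)"
      and 0: "\<And>\<kappa>. s $ \<kappa> = 0 \<Longrightarrow> \<bar>u \<bullet> query_diff x \<iota> \<kappa>\<bar> \<le> \<epsilon> $ \<kappa>"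
      and m1: "\<And>\<kappa>. s $ \<kappa> = -1 \<Longrightarrow> u \<bullet> query_diff x \<iota> \<kappa> < \<epsilon> $ \<kappa>"
      unfolding response_set_def by auto
    have "- (\<epsilon> $ \<kappa>) \<le> u \<bullet> (real_of_int (?s $ \<kappa>) *\<^sub>R query_diff x \<iota> \<kappa>)" for \<kappa>
      using assms[of \<kappa>] 1[of \<kappa>] 0[of \<kappa>] m1[of \<kappa>] by auto
    then show "u \<in> weak_response_set x B b \<Gamma> \<iota> ?s"
      unfolding weak_response_set_def using u \<epsilon> by blast
  qed
qed

lemma convex_initial_set: "convex (initial_set B b)"
proof -
  have "convex {u. b $ n \<le> (B *v u) $ n}" for n
    using convex_halfspace_ge[of "b $ n" "B $ n"]
    by (simp add: matrix_vector_mul_component)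
  then have "convex (\<Inter>n. {u. b $ n \<le> (B *v u) $ n})"
    by (intro convex_INT) auto
  then show ?thesis
    by (simp add: initial_set_def INTER_eq)
qed

lemma convex_error_set: "convex (error_set \<Gamma>)"
proof (rule convexI)
  fix \<epsilon> \<epsilon>' :: "real^'a" and p q :: real
  assume 1: "\<epsilon> \<in> error_set \<Gamma>" "\<epsilon>' \<in> error_set \<Gamma>" and pq: "0 \<le> p" "0 \<le> q" "p + q = 1"
  have "(\<Sum>\<kappa>\<in>UNIV. (p *\<^sub>R \<epsilon> + q *\<^sub>R \<epsilon>') $ \<kappa>) = p * (\<Sum>\<kappa>\<in>UNIV. \<epsilon> $ \<kappa>) + q * (\<Sum>\<kappa>\<in>UNIV. \<epsilon>' $ \<kappa>)"
    by (simp add: sum.distrib sum_distrib_left)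
  also have "\<dots> \<le> \<Gamma>"
    using 1 pq by (intro convex_bound_le) (auto simp: error_set_def)
  finally show "p *\<^sub>R \<epsilon> + q *\<^sub>R \<epsilon>' \<in> error_set \<Gamma>"
    using 1 pq by (simp add: error_set_def)
qed

text \<open>The set is the projection to \<open>u\<close> of a convex set of pairs
  \<open>(u, \<epsilon>)\<close>: utilities and their errors are combined with the same
  weights.\<close>

lemma convex_weak_response_set: "convex (weak_response_set x B b \<Gamma> \<iota> s)"
proof (rule convexI)
  fix u u' and p q :: real
  assume 1: "u \<in> weak_response_set x B b \<Gamma> \<iota> s" "u' \<in> weak_response_set x B b \<Gamma> \<iota> s"
    and pq: "0 \<le> p" "0 \<le> q" "p + q = 1"
  let ?d = "\<lambda>\<kappa>. real_of_int (s $ \<kappa>) *\<^sub>R query_diff x \<iota> \<kappa>"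
  obtain \<epsilon> where \<epsilon>: "\<epsilon> \<in> error_set \<Gamma>" "\<And>\<kappa>. - (\<epsilon> $ \<kappa>) \<le> u \<bullet> ?d \<kappa>"
    using 1(1) unfolding weak_response_set_def by blast
  obtain \<epsilon>' where \<epsilon>': "\<epsilon>' \<in> error_set \<Gamma>" "\<And>\<kappa>. - (\<epsilon>' $ \<kappa>) \<le> u' \<bullet> ?d \<kappa>"
    using 1(2) unfolding weak_response_set_def by blast
  have "p *\<^sub>R \<epsilon> + q *\<^sub>R \<epsilon>' \<in> error_set \<Gamma>"
    using convex_error_set \<epsilon>(1) \<epsilon>'(1) pq by (rule convexD)
  moreover have "- ((p *\<^sub>R \<epsilon> + q *\<^sub>R \<epsilon>') $ \<kappa>) \<le> (p *\<^sub>R u + q *\<^sub>R u') \<bullet> ?d \<kappa>" for \<kappa>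
    using add_mono[OF mult_left_mono[OF \<epsilon>(2)[of \<kappa>] pq(1)] mult_left_mono[OF \<epsilon>'(2)[of \<kappa>] pq(2)]]
    by (simp add: inner_add_left del: inner_scaleR_right)
  moreover have "p *\<^sub>R u + q *\<^sub>R u' \<in> initial_set B b"
    using 1 pq by (intro convexD[OF convex_initial_set]) (auto simp: weak_response_set_def)
  ultimately show "p *\<^sub>R u + q *\<^sub>R u' \<in> weak_response_set x B b \<Gamma> \<iota> s"
    unfolding weak_response_set_def by blast
qed

text \<open>A convex combination of a weak and a strict inequality is strict as soon as the strict
  one has positive weight. Hence a nonempty response set is dense in its polytope.\<close>

lemma segment_mem_response_set:
  assumes s: "s \<in> strict_responses"
    and u: "u \<in> weak_response_set x B b \<Gamma> \<iota> s" and u': "u' \<in> response_set x B b \<Gamma> \<iota> s"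
    and t: "0 < t" "t \<le> 1"
  shows "(1 - t) *\<^sub>R u + t *\<^sub>R u' \<in> response_set x B b \<Gamma> \<iota> s"
proof -
  let ?d = "\<lambda>\<kappa>. real_of_int (s $ \<kappa>) *\<^sub>R query_diff x \<iota> \<kappa>"
  obtain \<epsilon> where \<epsilon>: "\<epsilon> \<in> error_set \<Gamma>" "\<And>\<kappa>. - (\<epsilon> $ \<kappa>) \<le> u \<bullet> ?d \<kappa>"
    using u unfolding weak_response_set_def by blast
  obtain \<epsilon>' where \<epsilon>': "\<epsilon>' \<in> error_set \<Gamma>" "\<And>\<kappa>. - (\<epsilon>' $ \<kappa>) < u' \<bullet> ?d \<kappa>"
    using u' unfolding mem_response_set_strict_iff[OF s] by blast
  have t': "0 \<le> 1 - t"
    using t by simp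
  have "(1 - t) *\<^sub>R \<epsilon> + t *\<^sub>R \<epsilon>' \<in> error_set \<Gamma>"
    using t by (intro convexD[OF convex_error_set] \<epsilon> \<epsilon>') auto
  moreover have "- (((1 - t) *\<^sub>R \<epsilon> + t *\<^sub>R \<epsilon>') $ \<kappa>) < ((1 - t) *\<^sub>R u + t *\<^sub>R u') \<bullet> ?d \<kappa>" for \<kappa>
    using add_le_less_mono[OF mult_left_mono[OF \<epsilon>(2)[of \<kappa>] t'] mult_strict_left_mono[OF \<epsilon>'(2)[of \<kappa>] t(1)]]
    by (simp add: inner_add_left del: inner_scaleR_right)
  moreover have "(1 - t) *\<^sub>R u + t *\<^sub>R u' \<in> initial_set B b"
    using u u' t
    by (intro convexD[OF convex_initial_set]) (auto simp: weak_response_set_def response_set_def)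
  ultimately show ?thesis
    unfolding mem_response_set_strict_iff[OF s] by blast
qed

text \<open>
  If two weakly consistent utilities disagree on the sign of a comparison, their midpoint leaves
  slack there; spreading part of that error budget over all comparisons makes every one strict.
\<close>

lemma response_set_nonempty_if_opposite_signs:
  fixes s :: "int^'k::finite"
  assumes s: "s \<in> strict_responses"
    and u: "u \<in> weak_response_set x B b \<Gamma> \<iota> s" and u': "u' \<in> weak_response_set x B b \<Gamma> \<iota> s"
    and pos: "0 < u \<bullet> (real_of_int (s $ \<kappa>) *\<^sub>R query_diff x \<iota> \<kappa>)"
    and neg: "u' \<bullet> (real_of_int (s $ \<kappa>) *\<^sub>R query_diff x \<iota> \<kappa>) < 0"
  shows "response_set x B b \<Gamma> \<iota> s \<noteq> {}"
proof -
  let ?d = "\<lambda>\<kappa>. real_of_int (s $ \<kappa>) *\<^sub>R query_diff x \<iota> \<kappa>"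
  obtain \<epsilon> where \<epsilon>: "\<epsilon> \<in> error_set \<Gamma>" "\<And>\<kappa>. - (\<epsilon> $ \<kappa>) \<le> u \<bullet> ?d \<kappa>"
    using u unfolding weak_response_set_def by blast
  obtain \<epsilon>' where \<epsilon>': "\<epsilon>' \<in> error_set \<Gamma>" "\<And>\<kappa>. - (\<epsilon>' $ \<kappa>) \<le> u' \<bullet> ?d \<kappa>"
    using u' unfolding weak_response_set_def by blast
  define m where "m = (1/2) *\<^sub>R u + (1/2) *\<^sub>R u'"
  define \<eta> where "\<eta> = (1/2) *\<^sub>R \<epsilon> + (1/2) *\<^sub>R \<epsilon>'"
  have m_in: "m \<in> initial_set B b"
    unfolding m_def using u u'
    by (intro convexD[OF convex_initial_set]) (auto simp: weak_response_set_def)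
  have \<eta>_in: "\<eta> \<in> error_set \<Gamma>"
    unfolding \<eta>_def by (intro convexD[OF convex_error_set] \<epsilon> \<epsilon>') auto
  have md: "m \<bullet> ?d i = (u \<bullet> ?d i) / 2 + (u' \<bullet> ?d i) / 2" for i
    by (simp add: m_def inner_add_left del: inner_scaleR_right)
  have \<eta>i: "\<eta> $ i = \<epsilon> $ i / 2 + \<epsilon>' $ i / 2" for i
    by (simp add: \<eta>_def)
  have nonneg: "0 \<le> \<epsilon> $ i" "0 \<le> \<epsilon>' $ i" for i
    using \<epsilon>(1) \<epsilon>'(1) by (simp_all add: error_set_def)
  \<comment> \<open>The amount of error that \<kappa> can give up at the midpoint. The bound by
    \<open>u'\<close> also bounds \<open>\<epsilon>' $ \<kappa>\<close> from below and keeps the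
    reduced error nonnegative; the bound by \<open>u\<close> keeps the inequality at \<kappa>
    valid.\<close>
  define \<delta> where "\<delta> = min (u \<bullet> ?d \<kappa>) (- (u' \<bullet> ?d \<kappa>)) / 2"
  have \<delta>: "0 < \<delta>" "2 * \<delta> \<le> u \<bullet> ?d \<kappa>" "2 * \<delta> \<le> - (u' \<bullet> ?d \<kappa>)"
    using pos neg by (auto simp: \<delta>_def)
  \<comment> \<open>The released \<delta> is shared equally among all comparisons, \<kappa>
    included, so the total error does not change while every inequality gains \<gamma>.\<close>
  define \<gamma> where "\<gamma> = \<delta> / CARD('k)"
  define \<zeta> where "\<zeta> = (\<chi> i. \<eta> $ i + \<gamma> - (if i = \<kappa> then \<delta> else 0))"
  have \<gamma>: "0 < \<gamma>"
    using \<delta>(1) by (simp add: \<gamma>_def)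
  have "(\<Sum>i\<in>UNIV. \<zeta> $ i) = (\<Sum>i\<in>UNIV. \<eta> $ i)"
    by (simp add: \<zeta>_def \<gamma>_def sum.distrib sum_subtractf)
  moreover have "0 \<le> \<zeta> $ i" for i
    using \<eta>i[of i] nonneg[of i] \<delta> \<gamma> \<epsilon>'(2)[of \<kappa>] by (auto simp: \<zeta>_def)
  ultimately have "\<zeta> \<in> error_set \<Gamma>"
    using \<eta>_in by (simp add: error_set_def)
  moreover have "- (\<zeta> $ i) < m \<bullet> ?d i" for i
    using \<epsilon>(2)[of i] \<epsilon>'(2)[of i] \<eta>i[of i] md[of i] \<delta> \<gamma> nonneg(1)[of i] unfolding \<zeta>_def
    by (cases "i = \<kappa>") (simp_all del: inner_scaleR_right)
  ultimately have "m \<in> response_set x B b \<Gamma> \<iota> s"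
    unfolding mem_response_set_strict_iff[OF s] using m_in by blast
  then show ?thesis
    by blast
qed

text \<open>One pattern \<open>s'\<close> and one endpoint \<open>u'\<close> serve all
  \<open>u\<close>, so that a single recommendation for \<open>s'\<close> can later be used on the
  whole polytope. If the response set of \<open>s\<close> is empty, no comparison changes sign on
  the polytope, and \<open>s'\<close> is read off a point with as few zero comparisons as
  possible.\<close>

lemma weak_response_set_dense:
  fixes s :: "int^'k::finite"
  assumes "0 \<le> \<Gamma>" and s: "s \<in> strict_responses" and ne: "weak_response_set x B b \<Gamma> \<iota> s \<noteq> {}"
  shows "\<exists>s'\<in>responses x B b \<Gamma> \<iota>. \<exists>u'. \<forall>u\<in>weak_response_set x B b \<Gamma> \<iota> s. \<forall>t. 0 < t \<and> t \<le> 1 \<longrightarrow>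
    (1 - t) *\<^sub>R u + t *\<^sub>R u' \<in> response_set x B b \<Gamma> \<iota> s'"
proof (cases "response_set x B b \<Gamma> \<iota> s = {}")
  case False
  then obtain u' where "u' \<in> response_set x B b \<Gamma> \<iota> s"
    by blast
  moreover have "s \<in> responses x B b \<Gamma> \<iota>"
    using False s by (auto simp: responses_def strict_responses_def)
  ultimately show ?thesis
    using segment_mem_response_set[OF s] by blast
next
  case True
  let ?P = "weak_response_set x B b \<Gamma> \<iota> s" and ?d = "query_diff x \<iota>"
  have same: "0 \<le> (u \<bullet> ?d \<kappa>) * (u' \<bullet> ?d \<kappa>)" if "u \<in> ?P" "u' \<in> ?P" for u u' \<kappa>
  proof (rule ccontr)
    assume "\<not> 0 \<le> (u \<bullet> ?d \<kappa>) * (u' \<bullet> ?d \<kappa>)"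
    then have "(0 < u \<bullet> ?d \<kappa> \<and> u' \<bullet> ?d \<kappa> < 0) \<or> (0 < u' \<bullet> ?d \<kappa> \<and> u \<bullet> ?d \<kappa> < 0)"
      by (auto simp: not_le mult_less_0_iff)
    then show False
      using strict_response_cases[OF s, of \<kappa>] True
        response_set_nonempty_if_opposite_signs[OF s that, of \<kappa>]
        response_set_nonempty_if_opposite_signs[OF s that(2,1), of \<kappa>]
      by auto
  qed
  let ?supp = "\<lambda>u. {\<kappa>. u \<bullet> ?d \<kappa> \<noteq> 0}"
  \<comment> \<open>A point with the most nonzero comparisons plays the part of a relative interior
    point: what vanishes there vanishes on all of \<open>?P\<close>.\<close>
  have "\<exists>u'. u' \<in> ?P \<and> (\<forall>u. u \<in> ?P \<longrightarrow> card (?supp u) \<le> card (?supp u'))"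
  proof -
    obtain u0 where u0: "u0 \<in> ?P"
      using ne by blast
    have "\<forall>u. u \<in> ?P \<longrightarrow> card (?supp u) < CARD('k) + 1"
      by (simp add: card_mono le_imp_less_Suc)
    with u0 show ?thesis
      by (rule ex_has_greatest_nat)
  qed
  then obtain u' where u': "u' \<in> ?P" and max: "\<And>u. u \<in> ?P \<Longrightarrow> card (?supp u) \<le> card (?supp u')"
    by blast
  have supp: "u \<bullet> ?d \<kappa> = 0" if u: "u \<in> ?P" and z: "u' \<bullet> ?d \<kappa> = 0" for u \<kappa>
  proof (rule ccontr)
    assume nz: "u \<bullet> ?d \<kappa> \<noteq> 0"
    let ?m = "(1/2) *\<^sub>R u + (1/2) *\<^sub>R u'"
    \<comment> \<open>Since signs never conflict, nothing cancels at the midpoint, whose support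
      would therefore be strictly larger than the maximal one.\<close>
    have "?m \<bullet> ?d i \<noteq> 0" if "u' \<bullet> ?d i \<noteq> 0 \<or> i = \<kappa>" for i
      using same[OF u u', of i] that nz z
      by (auto simp: inner_add_left zero_le_mult_iff)
    then have "insert \<kappa> (?supp u') \<subseteq> ?supp ?m"
      by blast
    then have "card (insert \<kappa> (?supp u')) \<le> card (?supp ?m)"
      by (intro card_mono) auto
    moreover have "?m \<in> ?P"
      by (intro convexD[OF convex_weak_response_set] u u') auto
    ultimately show False
      using max[of ?m] z by simp
  qed
  \<comment> \<open>The error-free answers of \<open>u'\<close>, with ties reported as indifference.
    Along each segment the signs of \<open>u'\<close> persist, so zero error suffices there.\<close>
  define s' :: "int^'k" where
    "s' = (\<chi> \<kappa>. if u' \<bullet> ?d \<kappa> > 0 then 1 else if u' \<bullet> ?d \<kappa> < 0 then -1 else 0)"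
  have mem: "(1 - t) *\<^sub>R u + t *\<^sub>R u' \<in> response_set x B b \<Gamma> \<iota> s'"
    if u: "u \<in> ?P" and t: "0 < t" "t \<le> 1" for u t
  proof -
    let ?w = "(1 - t) *\<^sub>R u + t *\<^sub>R u'"
    have "?w \<in> initial_set B b"
      using u u' t by (intro convexD[OF convex_initial_set]) (auto simp: weak_response_set_def)
    moreover have "(0::real^'k) \<in> error_set \<Gamma>"
      using assms(1) by (simp add: error_set_def)
    moreover have wd: "?w \<bullet> ?d \<kappa> = (1 - t) * (u \<bullet> ?d \<kappa>) + t * (u' \<bullet> ?d \<kappa>)" for \<kappa>
      by (simp add: inner_add_left)
    have "?w \<bullet> ?d \<kappa> > 0" if "u' \<bullet> ?d \<kappa> > 0" for \<kappa>
      unfolding wd using same[OF u u', of \<kappa>] that t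
      by (intro add_nonneg_pos mult_nonneg_nonneg mult_pos_pos) (auto simp: zero_le_mult_iff)
    moreover have "?w \<bullet> ?d \<kappa> < 0" if "u' \<bullet> ?d \<kappa> < 0" for \<kappa>
      unfolding wd using same[OF u u', of \<kappa>] that t
      by (intro add_nonpos_neg mult_nonneg_nonpos mult_pos_neg) (auto simp: zero_le_mult_iff)
    moreover have "?w \<bullet> ?d \<kappa> = 0" if "u' \<bullet> ?d \<kappa> = 0" for \<kappa>
      unfolding wd using supp[OF u that] that by simp
    ultimately show ?thesis
      unfolding response_set_def by (auto simp: s'_def intro!: bexI[of _ 0] split: if_splits)
  qed
  have "response_set x B b \<Gamma> \<iota> s' \<noteq> {}"
    using mem[OF u', of 1] by auto
  then have "s' \<in> responses x B b \<Gamma> \<iota>"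
    by (simp add: responses_def s'_def)
  then show ?thesis
    using mem by blast
qed

section \<open>The value of fixed queries in terms of the polytopes\<close>

text \<open>Bounding a supremum means bounding each term, and the infimum over the finite nonempty
  \<open>R\<close> is attained, which gives the existential quantifier.\<close>

lemma worst_case_regret_le_iff:
  fixes R U :: "(real^'j) set"
  assumes "finite R" "R \<noteq> {}"
  shows "(INF y\<in>R. SUP u\<in>U. (SUP x'\<in>R. ereal (u \<bullet> x')) - ereal (u \<bullet> y)) \<le> ereal v \<longleftrightarrow>
    (\<exists>y\<in>R. \<forall>u\<in>U. \<forall>x'\<in>R. u \<bullet> (x' - y) \<le> v)"
proof -
  have "(SUP x'\<in>R. ereal (u \<bullet> x')) - ereal (u \<bullet> y) \<le> ereal v \<longleftrightarrow> (\<forall>x'\<in>R. u \<bullet> (x' - y) \<le> v)"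
    for u y
  proof -
    have "(SUP x'\<in>R. ereal (u \<bullet> x')) - ereal (u \<bullet> y) \<le> ereal v \<longleftrightarrow>
        (SUP x'\<in>R. ereal (u \<bullet> x')) \<le> ereal (v + u \<bullet> y)"
      by (subst ereal_minus_le_iff) (simp add: add.commute)
    also have "\<dots> \<longleftrightarrow> (\<forall>x'\<in>R. u \<bullet> (x' - y) \<le> v)"
      by (simp add: SUP_le_iff inner_diff_right algebra_simps)
    finally show ?thesis .
  qed
  then have *: "(SUP u\<in>U. (SUP x'\<in>R. ereal (u \<bullet> x')) - ereal (u \<bullet> y)) \<le> ereal v \<longleftrightarrow>
      (\<forall>u\<in>U. \<forall>x'\<in>R. u \<bullet> (x' - y) \<le> v)" for y
    by (simp add: SUP_le_iff)
  have "(INF y\<in>R. f y) \<le> c \<longleftrightarrow> (\<exists>y\<in>R. f y \<le> c)" for f :: "real^'j \<Rightarrow> ereal" and c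
    using assms by (simp add: Min_Inf[symmetric] Min_le_iff)
  then show ?thesis
    by (simp add: *)
qed

lemma le_if_segment_le:
  fixes p q v :: real
  assumes "\<And>t. 0 < t \<Longrightarrow> t \<le> 1 \<Longrightarrow> (1 - t) * p + t * q \<le> v"
  shows "p \<le> v"
proof (rule tendsto_upperbound)
  show "((\<lambda>t. (1 - t) * p + t * q) \<longlongrightarrow> p) (at_right 0)"
    by (auto intro!: tendsto_eq_intros)
  show "\<forall>\<^sub>F t in at_right 0. (1 - t) * p + t * q \<le> v"
    using assms by (auto simp: eventually_at_right_field intro!: exI[of _ 1])
qed simp

text \<open>From right to left, each response set lies in the polytope of a strict pattern. From
  left to right, the recommendation for the pattern given by \<open>weak_response_set_dense\<close>
  bounds the regret along all segments towards \<open>u'\<close>, and \<open>t\<close> tending to 0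
  extends the bound to the polytope. On an empty polytope any recommendation will do.\<close>

lemma qp_value_at_le_iff:
  fixes \<iota> :: "(nat \<times> nat)^'k::finite"
  assumes "0 \<le> \<Gamma>" "finite R" "R \<noteq> {}"
  shows "qp_value_at x R B b \<Gamma> \<iota> \<le> ereal v \<longleftrightarrow>
    (\<forall>s\<in>strict_responses. \<exists>y\<in>R. \<forall>u\<in>weak_response_set x B b \<Gamma> \<iota> s. \<forall>x'\<in>R. u \<bullet> (x' - y) \<le> v)"
    (is "_ \<longleftrightarrow> ?weak")
proof -
  have "qp_value_at x R B b \<Gamma> \<iota> \<le> ereal v \<longleftrightarrow>
      (\<forall>s\<in>responses x B b \<Gamma> \<iota>. \<exists>y\<in>R. \<forall>u\<in>response_set x B b \<Gamma> \<iota> s. \<forall>x'\<in>R. u \<bullet> (x' - y) \<le> v)"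
    (is "_ \<longleftrightarrow> ?strict")
    unfolding qp_value_at_def by (simp add: SUP_le_iff worst_case_regret_le_iff[OF assms(2,3)])
  also have "\<dots> \<longleftrightarrow> ?weak"
  proof
    assume strict: ?strict
    show ?weak
    proof
      fix s :: "int^'k"
      assume s: "s \<in> strict_responses"
      show "\<exists>y\<in>R. \<forall>u\<in>weak_response_set x B b \<Gamma> \<iota> s. \<forall>x'\<in>R. u \<bullet> (x' - y) \<le> v"
      proof (cases "weak_response_set x B b \<Gamma> \<iota> s = {}")
        case True
        then show ?thesis
          using assms(3) by auto
      next
        case False
        then obtain s' u' where s': "s' \<in> responses x B b \<Gamma> \<iota>"
          and seg: "\<And>u t. \<lbrakk>u \<in> weak_response_set x B b \<Gamma> \<iota> s; 0 < t; t \<le> 1\<rbrakk> \<Longrightarrow>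
            (1 - t) *\<^sub>R u + t *\<^sub>R u' \<in> response_set x B b \<Gamma> \<iota> s'"
          using weak_response_set_dense[OF assms(1) s] by metis
        obtain y where y: "y \<in> R"
          and le: "\<And>u x'. u \<in> response_set x B b \<Gamma> \<iota> s' \<Longrightarrow> x' \<in> R \<Longrightarrow> u \<bullet> (x' - y) \<le> v"
          using strict s' by blast
        have "u \<bullet> (x' - y) \<le> v" if "u \<in> weak_response_set x B b \<Gamma> \<iota> s" "x' \<in> R" for u x'
        proof (rule le_if_segment_le)
          fix t :: real
          assume "0 < t" "t \<le> 1"
          then show "(1 - t) * (u \<bullet> (x' - y)) + t * (u' \<bullet> (x' - y)) \<le> v"
            using le[OF seg[OF that(1)] that(2), of t] by (simp add: inner_add_left)
        qed
        then show ?thesis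
          using y by blast
      qed
    qed
  next
    assume weak: ?weak
    show ?strict
    proof
      fix s
      assume "s \<in> responses x B b \<Gamma> \<iota>"
      then have "\<And>\<kappa>. s $ \<kappa> \<in> {-1, 0, 1}"
        by (simp add: responses_def)
      from response_set_subset_weak[OF this, of x B b \<Gamma> \<iota>]
      show "\<exists>y\<in>R. \<forall>u\<in>response_set x B b \<Gamma> \<iota> s. \<forall>x'\<in>R. u \<bullet> (x' - y) \<le> v"
        using weak by (meson subsetD)
    qed
  qed
  finally show ?thesis .
qed

text \<open>Any utility in the initial set is consistent, with zero error, with its own truthful
  answers.\<close>

lemma weak_response_set_nonempty:
  fixes \<iota> :: "(nat \<times> nat)^'k::finite"
  assumes "0 \<le> \<Gamma>" "initial_set B b \<noteq> {}"
  shows "\<exists>s\<in>strict_responses. weak_response_set x B b \<Gamma> \<iota> s \<noteq> {}"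
proof -
  obtain u where u: "u \<in> initial_set B b"
    using assms(2) by blast
  define s :: "int^'k" where "s = (\<chi> \<kappa>. if u \<bullet> query_diff x \<iota> \<kappa> < 0 then -1 else 1)"
  have "(0::real^'k) \<in> error_set \<Gamma>"
    using assms(1) by (simp add: error_set_def)
  then have "u \<in> weak_response_set x B b \<Gamma> \<iota> s"
    using u unfolding weak_response_set_def by (auto simp: s_def intro!: bexI[of _ 0])
  moreover have "s \<in> strict_responses"
    by (simp add: s_def strict_responses_def)
  ultimately show ?thesis
    by blast
qed

text \<open>Finiteness lets the value itself be used as the real variable \<open>tau\<close>.
  Boundedness of the initial set and of \<open>R\<close> gives the upper bound.\<close>

lemma qp_value_at_real:
  fixes \<iota> :: "(nat \<times> nat)^'k::finite"
  assumes "0 \<le> \<Gamma>" "finite R" "R \<noteq> {}" "initial_set B b \<noteq> {}" "bounded (initial_set B b)"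
  shows "\<exists>v. qp_value_at x R B b \<Gamma> \<iota> = ereal v"
proof -
  obtain C where C: "\<And>u. u \<in> initial_set B b \<Longrightarrow> norm u \<le> C"
    using assms(5) bounded_iff by blast
  obtain D where D: "\<And>y. y \<in> R \<Longrightarrow> norm y \<le> D"
    using finite_imp_bounded[OF assms(2)] bounded_iff by blast
  have "0 \<le> C"
    using C assms(4) norm_ge_zero order_trans by blast
  have "u \<bullet> (x' - y) \<le> C * (D + D)" if "u \<in> initial_set B b" "x' \<in> R" "y \<in> R" for u x' y
  proof -
    have "u \<bullet> (x' - y) \<le> norm u * norm (x' - y)"
      by (rule norm_cauchy_schwarz)
    also have "\<dots> \<le> C * (D + D)"
      using C[OF that(1)] D[OF that(2)] D[OF that(3)] norm_triangle_ineq4[of x' y] \<open>0 \<le> C\<close>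
      by (intro mult_mono) auto
    finally show ?thesis .
  qed
  then have "qp_value_at x R B b \<Gamma> \<iota> \<le> ereal (C * (D + D))"
    unfolding qp_value_at_le_iff[OF assms(1-3)] using assms(3)
    by (auto simp: weak_response_set_def)
  \<comment> \<open>On a nonempty polytope the choice \<open>x' = y\<close> already gives regret
    0.\<close>
  moreover have "\<not> qp_value_at x R B b \<Gamma> \<iota> \<le> ereal (- 1)"
    unfolding qp_value_at_le_iff[OF assms(1-3)]
    using weak_response_set_nonempty[OF assms(1,4), of x \<iota>] by fastforce
  ultimately show ?thesis
    by (cases "qp_value_at x R B b \<Gamma> \<iota>") auto
qed

section \<open>Binary encoding of queries\<close>

lemma binary_sum_one_index:
  fixes f :: "nat \<Rightarrow> real"
  assumes bin: "\<And>i. i \<in> {1..I} \<Longrightarrow> f i \<in> {0, 1}" and sum: "(\<Sum>i=1..I. f i) = 1"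
  defines "k \<equiv> \<Sum>i=1..I. i * of_bool (f i = 1)"
  shows "k \<in> {1..I}" and "\<And>i. i \<in> {1..I} \<Longrightarrow> f i = of_bool (i = k)"
proof -
  let ?A = "{i \<in> {1..I}. f i = 1}"
  have "(\<Sum>i=1..I. f i) = (\<Sum>i=1..I. if f i = 1 then 1 else 0)"
    using bin by (intro sum.cong) auto
  also have "\<dots> = real (card ?A)"
    by (simp flip: sum.inter_filter)
  finally have "card ?A = 1"
    using sum by simp
  then obtain j where j: "?A = {j}"
    using card_1_singletonE by blast
  have "k = (\<Sum>i\<in>?A. i)"
    unfolding k_def sum.inter_filter[OF finite_atLeastAtMost] by (intro sum.cong) auto
  then have k: "k = j"
    unfolding j by simp
  show "k \<in> {1..I}"
    using j k by blast
  fix i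
  assume "i \<in> {1..I}"
  then show "f i = of_bool (i = k)"
    using bin[of i] j k by auto
qed

text \<open>With \<alpha> for \<open>g\<close> and the answers for \<open>r\<close>, this turns the
  sum over items in the program into the sum over queries in
  \<open>robust_dual_exists\<close>.\<close>

lemma sum_selected_items:
  fixes x :: "nat \<Rightarrow> real^'j" and g :: "'k::finite \<Rightarrow> real"
  assumes "\<And>\<kappa>. p \<kappa> \<in> {1..I}" "\<And>\<kappa>. q \<kappa> \<in> {1..I}"
  shows "(\<Sum>i=1..I. (\<Sum>\<kappa>\<in>UNIV. r \<kappa> * (g \<kappa> * of_bool (i = p \<kappa>) - g \<kappa> * of_bool (i = q \<kappa>))) *\<^sub>R x i)
    = (\<Sum>\<kappa>\<in>UNIV. g \<kappa> *\<^sub>R (r \<kappa> *\<^sub>R (x (p \<kappa>) - x (q \<kappa>))))"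
proof -
  have one: "(\<Sum>i=1..I. (c * of_bool (i = k)) *\<^sub>R x i) = c *\<^sub>R x k" if "k \<in> {1..I}" for c k
  proof -
    have "(\<Sum>i=1..I. (c * of_bool (i = k)) *\<^sub>R x i) = (\<Sum>i=1..I. if i = k then c *\<^sub>R x i else 0)"
      by (intro sum.cong) auto
    then show ?thesis
      using that by simp
  qed
  have "(\<Sum>i=1..I. (\<Sum>\<kappa>\<in>UNIV. r \<kappa> * (g \<kappa> * of_bool (i = p \<kappa>) - g \<kappa> * of_bool (i = q \<kappa>))) *\<^sub>R x i)
    = (\<Sum>\<kappa>\<in>UNIV. \<Sum>i=1..I. (r \<kappa> * g \<kappa> * of_bool (i = p \<kappa>)) *\<^sub>R x i - (r \<kappa> * g \<kappa> * of_bool (i = q \<kappa>)) *\<^sub>R x i)"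
    unfolding scaleR_sum_left by (subst sum.swap) (simp add: algebra_simps)
  also have "\<dots> = (\<Sum>\<kappa>\<in>UNIV. g \<kappa> *\<^sub>R (r \<kappa> *\<^sub>R (x (p \<kappa>) - x (q \<kappa>))))"
    unfolding sum_subtractf one[OF assms(1)] one[OF assms(2)]
    by (simp add: algebra_simps flip: sum_subtractf)
  finally show ?thesis .
qed

text \<open>Binary vectors of sum one are unit vectors, whose positions the encoding reads off; the
  remaining query constraint puts the position of \<open>vsel\<close> strictly before that of
  \<open>wsel\<close>.\<close>

lemma encoded_queries_selection:
  fixes p :: "('j::finite, 'k::finite, 'n::finite) milp_point"
  assumes "p \<in> milp_feasible I x R B b \<Gamma> M"
  shows "encoded_queries I p \<in> query_sets I"
    and "i \<in> {1..I} \<Longrightarrow> vsel p \<kappa> i = of_bool (i = fst (encoded_queries I p $ \<kappa>))"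
    and "i \<in> {1..I} \<Longrightarrow> wsel p \<kappa> i = of_bool (i = snd (encoded_queries I p $ \<kappa>))"
proof -
  let ?\<iota> = "encoded_queries I p"
  have dom: "milp_domain I R p" and q: "milp_query_constraints I p"
    using assms by (simp_all add: milp_feasible_def)
  have v: "vsel p \<kappa> i \<in> {0, 1}" "wsel p \<kappa> i \<in> {0, 1}" if "i \<in> {1..I}" for \<kappa> i
    using dom that unfolding milp_domain_def by blast+
  have sum: "(\<Sum>i=1..I. vsel p \<kappa> i) = 1" "(\<Sum>i=1..I. wsel p \<kappa> i) = 1" for \<kappa>
    using q unfolding milp_query_constraints_def by blast+
  have order: "(\<Sum>i'=i..I. vsel p \<kappa> i') \<le> 1 - wsel p \<kappa> i" if "i \<in> {1..I}" for \<kappa> i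
    using q that unfolding milp_query_constraints_def by blast
  have fst: "fst (?\<iota> $ \<kappa>) = (\<Sum>i=1..I. i * of_bool (vsel p \<kappa> i = 1))"
    and snd: "snd (?\<iota> $ \<kappa>) = (\<Sum>i=1..I. i * of_bool (wsel p \<kappa> i = 1))" for \<kappa>
    by (simp_all add: encoded_queries_def)
  have vsel: "vsel p \<kappa> i = of_bool (i = fst (?\<iota> $ \<kappa>))" if "i \<in> {1..I}" for \<kappa> i
    unfolding fst by (rule binary_sum_one_index(2)[OF _ sum(1) that]) (rule v)
  have wsel: "wsel p \<kappa> i = of_bool (i = snd (?\<iota> $ \<kappa>))" if "i \<in> {1..I}" for \<kappa> i
    unfolding snd by (rule binary_sum_one_index(2)[OF _ sum(2) that]) (rule v)
  show "i \<in> {1..I} \<Longrightarrow> vsel p \<kappa> i = of_bool (i = fst (?\<iota> $ \<kappa>))"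
    "i \<in> {1..I} \<Longrightarrow> wsel p \<kappa> i = of_bool (i = snd (?\<iota> $ \<kappa>))"
    by (fact vsel, fact wsel)
  have "?\<iota> $ \<kappa> \<in> comparisons I" for \<kappa>
  proof -
    let ?i = "fst (?\<iota> $ \<kappa>)" and ?i' = "snd (?\<iota> $ \<kappa>)"
    have i: "?i \<in> {1..I}" "?i' \<in> {1..I}"
      unfolding fst snd
      by (rule binary_sum_one_index(1)[OF _ sum(1)], rule v, assumption)
        (rule binary_sum_one_index(1)[OF _ sum(2)], rule v, assumption)
    \<comment> \<open>Otherwise the tail sum of \<open>vsel\<close> from \<open>?i'\<close> contains
      its one, while the constraint at \<open>?i'\<close> has right-hand side 0.\<close>
    have "?i < ?i'"
    proof (rule ccontr)
      assume "\<not> ?i < ?i'"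
      then have "?i \<in> {?i'..I}"
        using i by auto
      moreover have "0 \<le> vsel p \<kappa> j" if "j \<in> {?i'..I}" for j
        using vsel[of j \<kappa>] i that by auto
      ultimately have "vsel p \<kappa> ?i \<le> (\<Sum>i'=?i'..I. vsel p \<kappa> i')"
        by (intro member_le_sum) auto
      then show False
        using order[OF i(2), of \<kappa>] wsel[OF i(2), of \<kappa>] vsel[OF i(1), of \<kappa>] by simp
    qed
    then show ?thesis
      using i by (simp add: comparisons_def split_beta)
  qed
  then show "?\<iota> \<in> query_sets I"
    by (simp add: query_sets_def)
qed

lemma query_sets_items:
  assumes "\<iota> \<in> query_sets I"
  shows "fst (\<iota> $ \<kappa>) \<in> {1..I}" "snd (\<iota> $ \<kappa>) \<in> {1..I}" "fst (\<iota> $ \<kappa>) < snd (\<iota> $ \<kappa>)"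
proof -
  have "\<iota> $ \<kappa> \<in> comparisons I"
    using assms by (simp add: query_sets_def)
  then show "fst (\<iota> $ \<kappa>) \<in> {1..I}" "snd (\<iota> $ \<kappa>) \<in> {1..I}" "fst (\<iota> $ \<kappa>) < snd (\<iota> $ \<kappa>)"
    by (auto simp: comparisons_def)
qed

section \<open>Weak and strong duality for the program with fixed queries\<close>

text \<open>Pairing the equality constraint with \<open>u\<close> expresses the regret through the
  multipliers, whose signs then bound it by the dual objective.\<close>

lemma milp_weak_duality:
  fixes p :: "('j::finite, 'k::finite, 'n::finite) milp_point"
  assumes p: "p \<in> milp_feasible I x R B b \<Gamma> M" and s: "s \<in> strict_responses" and x': "x' \<in> R"
    and u: "u \<in> weak_response_set x B b \<Gamma> (encoded_queries I p) s"
  shows "u \<bullet> (x' - rec p s) \<le> tau p"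
proof -
  define \<iota> where "\<iota> = encoded_queries I p"
  define \<alpha> \<beta> \<mu> where "\<alpha> = alpha p x' s" and "\<beta> = beta p x' s" and "\<mu> = mu p x' s"
  let ?d = "\<lambda>\<kappa>. real_of_int (s $ \<kappa>) *\<^sub>R query_diff x \<iota> \<kappa>"
  have \<iota>: "\<iota> \<in> query_sets I"
    unfolding \<iota>_def using p by (rule encoded_queries_selection)
  have dom: "milp_domain I R p" and dual: "milp_dual_constraints I x R B b \<Gamma> p"
    and link: "milp_linking_constraints I R M p"
    using p by (simp_all add: milp_feasible_def)
  have signs: "\<alpha> $ \<kappa> \<le> 0" "\<beta> $ n \<le> 0" "0 \<le> \<mu>" for \<kappa> n
    using dom s x' unfolding milp_domain_def \<alpha>_def \<beta>_def \<mu>_def by blast+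
  have bars: "vbar p x' s \<kappa> i \<le> 0" "wbar p x' s \<kappa> i \<le> 0" if "i \<in> {1..I}" for \<kappa> i
    using dom s x' that unfolding milp_domain_def by blast+
  have tau: "b \<bullet> \<beta> + \<Gamma> * \<mu> \<le> tau p" and \<alpha>\<mu>: "0 \<le> \<alpha> $ \<kappa> + \<mu>"
    and eq: "(\<Sum>i=1..I. (\<Sum>\<kappa>\<in>UNIV. real_of_int (s $ \<kappa>) * (vbar p x' s \<kappa> i - wbar p x' s \<kappa> i)) *\<^sub>R x i)
          + transpose B *v \<beta> = x' - rec p s" for \<kappa>
    using dual s x' unfolding milp_dual_constraints_def \<alpha>_def \<beta>_def \<mu>_def by blast+
  \<comment> \<open>A selected entry is squeezed to \<alpha> by the second and third linking bounds,
    any other entry to 0 by the first bound and its own sign.\<close>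
  have vbar: "vbar p x' s \<kappa> i = \<alpha> $ \<kappa> * of_bool (i = fst (\<iota> $ \<kappa>))" if i: "i \<in> {1..I}" for \<kappa> i
  proof -
    have "vbar p x' s \<kappa> i \<ge> - M * vsel p \<kappa> i" "vbar p x' s \<kappa> i \<ge> \<alpha> $ \<kappa>"
        "vbar p x' s \<kappa> i \<le> \<alpha> $ \<kappa> + M * (1 - vsel p \<kappa> i)"
      using link s x' i unfolding milp_linking_constraints_def \<alpha>_def by blast+
    then show ?thesis
      using bars(1)[OF i, of \<kappa>] encoded_queries_selection(2)[OF p i, of \<kappa>]
      by (auto simp: \<iota>_def of_bool_def split: if_splits)
  qed
  have wbar: "wbar p x' s \<kappa> i = \<alpha> $ \<kappa> * of_bool (i = snd (\<iota> $ \<kappa>))" if i: "i \<in> {1..I}" for \<kappa> i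
  proof -
    have "wbar p x' s \<kappa> i \<ge> - M * wsel p \<kappa> i" "wbar p x' s \<kappa> i \<ge> \<alpha> $ \<kappa>"
        "wbar p x' s \<kappa> i \<le> \<alpha> $ \<kappa> + M * (1 - wsel p \<kappa> i)"
      using link s x' i unfolding milp_linking_constraints_def \<alpha>_def by blast+
    then show ?thesis
      using bars(2)[OF i, of \<kappa>] encoded_queries_selection(3)[OF p i, of \<kappa>]
      by (auto simp: \<iota>_def of_bool_def split: if_splits)
  qed
  have "(\<Sum>i=1..I. (\<Sum>\<kappa>\<in>UNIV. real_of_int (s $ \<kappa>) * (vbar p x' s \<kappa> i - wbar p x' s \<kappa> i)) *\<^sub>R x i)
      = (\<Sum>\<kappa>\<in>UNIV. \<alpha> $ \<kappa> *\<^sub>R ?d \<kappa>)"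
    using sum_selected_items[where x = x and g = "\<lambda>\<kappa>. \<alpha> $ \<kappa>" and r = "\<lambda>\<kappa>. real_of_int (s $ \<kappa>)",
        OF query_sets_items(1,2)[OF \<iota>]]
    by (simp add: vbar wbar query_diff_def)
  then have c: "x' - rec p s = (\<Sum>\<kappa>\<in>UNIV. \<alpha> $ \<kappa> *\<^sub>R ?d \<kappa>) + transpose B *v \<beta>"
    using eq by simp
  obtain \<epsilon> where \<epsilon>: "\<epsilon> \<in> error_set \<Gamma>" "\<And>\<kappa>. - (\<epsilon> $ \<kappa>) \<le> u \<bullet> ?d \<kappa>"
    using u unfolding weak_response_set_def \<iota>_def by blast
  have Bu: "b $ n \<le> (B *v u) $ n" for n
    using u by (simp add: weak_response_set_def initial_set_def)
  have "u \<bullet> (x' - rec p s) = (\<Sum>\<kappa>\<in>UNIV. \<alpha> $ \<kappa> * (u \<bullet> ?d \<kappa>)) + (B *v u) \<bullet> \<beta>"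
    unfolding c inner_add_right inner_transpose_mult inner_sum_right inner_scaleR_right ..
  \<comment> \<open>The multiplier \<mu> prices the error budget: no query can charge more than
    \<mu> per unit of error.\<close>
  also have "(\<Sum>\<kappa>\<in>UNIV. \<alpha> $ \<kappa> * (u \<bullet> ?d \<kappa>)) \<le> (\<Sum>\<kappa>\<in>UNIV. \<mu> * \<epsilon> $ \<kappa>)"
  proof (rule sum_mono)
    fix \<kappa>
    have "\<alpha> $ \<kappa> * (u \<bullet> ?d \<kappa>) \<le> \<alpha> $ \<kappa> * (- (\<epsilon> $ \<kappa>))"
      using \<epsilon>(2) signs(1) by (rule mult_left_mono_neg)
    also have "\<dots> = (- \<alpha> $ \<kappa>) * \<epsilon> $ \<kappa>"
      by simp
    also have "\<dots> \<le> \<mu> * \<epsilon> $ \<kappa>"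
      using \<epsilon>(1) \<alpha>\<mu>[of \<kappa>] by (intro mult_right_mono) (auto simp: error_set_def)
    finally show "\<alpha> $ \<kappa> * (u \<bullet> ?d \<kappa>) \<le> \<mu> * \<epsilon> $ \<kappa>" .
  qed
  also have "(\<Sum>\<kappa>\<in>UNIV. \<mu> * \<epsilon> $ \<kappa>) \<le> \<mu> * \<Gamma>"
    using \<epsilon>(1) signs(3) by (auto simp: error_set_def sum_distrib_left[symmetric] intro: mult_left_mono)
  also have "(B *v u) \<bullet> \<beta> \<le> b \<bullet> \<beta>"
    unfolding inner_vec_def using Bu signs(2) by (auto intro!: sum_mono mult_right_mono_neg)
  finally show ?thesis
    using tau by (simp add: mult.commute)
qed

lemma finite_vec_set:
  assumes "finite A"
  shows "finite {v :: 'a^'k::finite. \<forall>\<kappa>. v $ \<kappa> \<in> A}"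
proof -
  have "finite (vec_lambda ` PiE (UNIV :: 'k set) (\<lambda>_. A))"
    using assms by (intro finite_imageI finite_PiE) auto
  moreover have "{v :: 'a^'k. \<forall>\<kappa>. v $ \<kappa> \<in> A} \<subseteq> vec_lambda ` PiE UNIV (\<lambda>_. A)"
  proof
    fix v :: "'a^'k"
    assume "v \<in> {v. \<forall>\<kappa>. v $ \<kappa> \<in> A}"
    then have "vec_nth v \<in> PiE UNIV (\<lambda>_. A)"
      by auto
    then show "v \<in> vec_lambda ` PiE UNIV (\<lambda>_. A)"
      by (metis image_eqI vec_nth_inverse)
  qed
  ultimately show ?thesis
    by (rule finite_subset[rotated])
qed

lemma finite_strict_responses: "finite (strict_responses :: (int^'k::finite) set)"
  unfolding strict_responses_def by (rule finite_vec_set) simp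

lemma finite_query_sets: "finite (query_sets I :: ((nat \<times> nat)^'k::finite) set)"
proof -
  have "comparisons I \<subseteq> {1..I} \<times> {1..I}"
    by (auto simp: comparisons_def)
  then have "finite (comparisons I)"
    by (rule finite_subset) simp
  then show ?thesis
    unfolding query_sets_def by (rule finite_vec_set)
qed

text \<open>For each pattern a recommendation achieving the bound is fixed, and
  \<open>robust_dual_exists\<close> supplies multipliers for each \<open>x'\<close>. These do not
  involve \<open>M\<close>, so the threshold can be chosen after them.\<close>

lemma milp_strong_duality:
  fixes x :: "nat \<Rightarrow> real^'j" and B :: "real^'j^'n" and \<iota> :: "(nat \<times> nat)^'k::finite"
  assumes "finite R" "initial_set B b \<noteq> {}" "bounded (initial_set B b)" "\<iota> \<in> query_sets I"
    and regret: "\<forall>s\<in>strict_responses. \<exists>y\<in>R. \<forall>u\<in>weak_response_set x B b \<Gamma> \<iota> s. \<forall>x'\<in>R. u \<bullet> (x' - y) \<le> v"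
  shows "\<exists>m. \<forall>M\<ge>m. \<exists>p \<in> (milp_feasible I x R B b \<Gamma> M :: ('j, 'k, 'n) milp_point set).
    encoded_queries I p = \<iota> \<and> tau p = v"
proof -
  let ?d = "\<lambda>s \<kappa>. real_of_int (s $ \<kappa>) *\<^sub>R query_diff x \<iota> \<kappa>"
  note \<iota> = query_sets_items[OF assms(4)]
  from regret obtain y where y: "\<And>s. s \<in> strict_responses \<Longrightarrow> y s \<in> R"
    and le: "\<And>s u x'. \<lbrakk>s \<in> strict_responses; u \<in> weak_response_set x B b \<Gamma> \<iota> s; x' \<in> R\<rbrakk> \<Longrightarrow> u \<bullet> (x' - y s) \<le> v"
    by metis
  define dual_point where "dual_point x' s \<alpha> \<beta> \<mu> \<longleftrightarrow>
    (\<forall>\<kappa>. \<alpha> $ \<kappa> \<le> 0) \<and> (\<forall>n. \<beta> $ n \<le> 0) \<and> 0 \<le> \<mu> \<and> b \<bullet> \<beta> + \<Gamma> * \<mu> \<le> v \<and>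
    (\<Sum>\<kappa>\<in>UNIV. \<alpha> $ \<kappa> *\<^sub>R ?d s \<kappa>) + transpose B *v \<beta> = x' - y s \<and> (\<forall>\<kappa>. 0 \<le> \<alpha> $ \<kappa> + \<mu>)"
    for x' and s :: "int^'k" and \<alpha> :: "real^'k" and \<beta> :: "real^'n" and \<mu>
  have "\<exists>\<alpha> \<beta> \<mu>. dual_point x' s \<alpha> \<beta> \<mu>" if "x' \<in> R" "s \<in> strict_responses" for x' s
    unfolding dual_point_def
  proof (rule robust_dual_exists[OF assms(2,3)])
    fix u and \<epsilon> :: "real^'k"
    assume "u \<in> initial_set B b" "\<epsilon> \<in> error_set \<Gamma>" "\<And>\<kappa>. - (\<epsilon> $ \<kappa>) \<le> u \<bullet> ?d s \<kappa>"
    then have "u \<in> weak_response_set x B b \<Gamma> \<iota> s"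
      unfolding weak_response_set_def by blast
    then show "u \<bullet> (x' - y s) \<le> v"
      using le that by blast
  qed
  then obtain \<alpha> \<beta> \<mu> where
    "\<And>x' s. x' \<in> R \<Longrightarrow> s \<in> strict_responses \<Longrightarrow> dual_point x' s (\<alpha> x' s) (\<beta> x' s) (\<mu> x' s)"
    by metis
  note dual = this[unfolded dual_point_def]
  \<comment> \<open>The threshold \<open>m\<close> is an upper bound of the finitely many magnitudes
    of \<alpha>.\<close>
  have "finite ((\<lambda>(x', s, \<kappa>). - \<alpha> x' s $ \<kappa>) ` (R \<times> strict_responses \<times> UNIV))"
    using assms(1) finite_strict_responses by (intro finite_imageI finite_cartesian_product) auto
  then obtain m where le_m: "\<And>z. z \<in> (\<lambda>(x', s, \<kappa>). - \<alpha> x' s $ \<kappa>) ` (R \<times> strict_responses \<times> UNIV) \<Longrightarrow> z \<le> m"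
    using bdd_above_finite bdd_above_def by metis
  have m: "- m \<le> \<alpha> x' s $ \<kappa>" if "x' \<in> R" "s \<in> strict_responses" for x' s \<kappa>
  proof -
    have "- \<alpha> x' s $ \<kappa> \<le> m"
      by (rule le_m, rule image_eqI[of _ _ "(x', s, \<kappa>)"]) (use that in auto)
    then show ?thesis
      by simp
  qed
  show ?thesis
  proof (intro exI allI impI)
    fix M
    assume "m \<le> M"
    then have M: "- M \<le> \<alpha> x' s $ \<kappa>" if "x' \<in> R" "s \<in> strict_responses" for x' s \<kappa>
      using m[OF that, of \<kappa>] by simp
    define p :: "('j, 'k, 'n) milp_point" where
      "p = \<lparr>tau = v, vsel = (\<lambda>\<kappa> i. of_bool (i = fst (\<iota> $ \<kappa>))), wsel = (\<lambda>\<kappa> i. of_bool (i = snd (\<iota> $ \<kappa>))),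
        rec = y, alpha = \<alpha>, beta = \<beta>, mu = \<mu>,
        vbar = (\<lambda>x' s \<kappa> i. \<alpha> x' s $ \<kappa> * of_bool (i = fst (\<iota> $ \<kappa>))),
        wbar = (\<lambda>x' s \<kappa> i. \<alpha> x' s $ \<kappa> * of_bool (i = snd (\<iota> $ \<kappa>)))\<rparr>"
    have "milp_domain I R p"
      using y dual unfolding milp_domain_def by (simp add: p_def)
    moreover have "milp_dual_constraints I x R B b \<Gamma> p"
      unfolding milp_dual_constraints_def
    proof (intro ballI)
      fix s :: "int^'k" and x'
      assume s: "s \<in> strict_responses" and x': "x' \<in> R"
      have "(\<Sum>i=1..I. (\<Sum>\<kappa>\<in>UNIV. real_of_int (s $ \<kappa>) * (vbar p x' s \<kappa> i - wbar p x' s \<kappa> i)) *\<^sub>R x i)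
          = (\<Sum>\<kappa>\<in>UNIV. \<alpha> x' s $ \<kappa> *\<^sub>R ?d s \<kappa>)"
        using sum_selected_items[where x = x and g = "\<lambda>\<kappa>. \<alpha> x' s $ \<kappa>" and r = "\<lambda>\<kappa>. real_of_int (s $ \<kappa>)",
            OF \<iota>(1,2)]
        by (simp add: p_def query_diff_def)
      then show "tau p \<ge> b \<bullet> beta p x' s + \<Gamma> * mu p x' s \<and>
        (\<Sum>i=1..I. (\<Sum>\<kappa>\<in>UNIV. real_of_int (s $ \<kappa>) * (vbar p x' s \<kappa> i - wbar p x' s \<kappa> i)) *\<^sub>R x i)
          + transpose B *v beta p x' s = x' - rec p s \<and>
        (\<forall>\<kappa>. alpha p x' s $ \<kappa> + mu p x' s \<ge> 0)"
        using dual[OF x' s] by (simp add: p_def)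
    qed
    moreover have "milp_query_constraints I p"
    proof -
      have sum: "(\<Sum>i'=i..I. of_bool (i' = k)) = (of_bool (i \<le> k) :: real)" if "k \<le> I" for i k
        using that by (simp add: of_bool_def)
      have v: "(\<Sum>i'=i..I. vsel p \<kappa> i') = of_bool (i \<le> fst (\<iota> $ \<kappa>))"
        and w: "(\<Sum>i'=i..I. wsel p \<kappa> i') = of_bool (i \<le> snd (\<iota> $ \<kappa>))" for i \<kappa>
        using \<iota>(1,2)[of \<kappa>] unfolding p_def milp_point.simps by (auto intro!: sum)
      \<comment> \<open>The right-hand side is 0 only at the second item of the query, and there the
        tail sum vanishes because the first item comes earlier.\<close>
      have "(\<Sum>i'=i..I. vsel p \<kappa> i') \<le> 1 - wsel p \<kappa> i" for i \<kappa>
        unfolding v using \<iota>(3)[of \<kappa>] by (simp add: p_def)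
      then show ?thesis
        unfolding milp_query_constraints_def v w using \<iota>(1,2) by auto
    qed
    moreover have "milp_linking_constraints I R M p"
      unfolding milp_linking_constraints_def
    proof (intro ballI allI)
      fix s :: "int^'k" and x' \<kappa> i
      assume s: "s \<in> strict_responses" and x': "x' \<in> R"
      have "- M \<le> \<alpha> x' s $ \<kappa>" "\<alpha> x' s $ \<kappa> \<le> 0"
        using M[OF x' s] dual[OF x' s] by auto
      then show "vbar p x' s \<kappa> i \<ge> - M * vsel p \<kappa> i \<and>
          vbar p x' s \<kappa> i \<ge> alpha p x' s $ \<kappa> \<and>
          vbar p x' s \<kappa> i \<le> alpha p x' s $ \<kappa> + M * (1 - vsel p \<kappa> i) \<and>
          wbar p x' s \<kappa> i \<ge> - M * wsel p \<kappa> i \<and>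
          wbar p x' s \<kappa> i \<ge> alpha p x' s $ \<kappa> \<and>
          wbar p x' s \<kappa> i \<le> alpha p x' s $ \<kappa> + M * (1 - wsel p \<kappa> i)"
        by (simp add: p_def of_bool_def)
    qed
    ultimately have "p \<in> milp_feasible I x R B b \<Gamma> M"
      by (simp add: milp_feasible_def)
    moreover have "encoded_queries I p = \<iota>"
    proof -
      have "(\<Sum>i=1..I. i * of_bool (i = k)) = k" if "k \<in> {1..I}" for k :: nat
      proof -
        have "(\<Sum>i=1..I. i * of_bool (i = k)) = (\<Sum>i=1..I. if i = k then i else 0)"
          by (intro sum.cong) auto
        then show ?thesis
          using that by simp
      qed
      then show ?thesis
        using \<iota>(1,2) by (simp add: encoded_queries_def p_def vec_eq_iff prod_eq_iff)
    qed
    ultimately show "\<exists>p \<in> (milp_feasible I x R B b \<Gamma> M :: ('j, 'k, 'n) milp_point set).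
        encoded_queries I p = \<iota> \<and> tau p = v"
      by (intro bexI[of _ p]) (simp_all add: p_def)
  qed
qed

section \<open>Equality of the values for fixed queries and overall\<close>

text \<open>Weak duality gives one inequality for every \<open>M\<close>; strong duality, applied at
  the finite value itself, gives the other for large \<open>M\<close>. For empty \<open>R\<close>
  both sides are infinite.\<close>

lemma milp_value_at_eq_qp_value_at:
  fixes x :: "nat \<Rightarrow> real^'j" and B :: "real^'j^'n"
  assumes "finite R" "initial_set B b \<noteq> {}" "bounded (initial_set B b)" "0 \<le> \<Gamma>"
    and \<iota>: "\<iota> \<in> (query_sets I :: ((nat \<times> nat)^'k::finite) set)"
  shows "\<exists>m. \<forall>M\<ge>m. milp_value_at I x R B b \<Gamma> M \<iota> = qp_value_at x R B b \<Gamma> \<iota>"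
proof -
  note le_iff = qp_value_at_le_iff[OF assms(4,1)]
  have ge: "qp_value_at x R B b \<Gamma> \<iota> \<le> milp_value_at I x R B b \<Gamma> M \<iota>" for M
    unfolding milp_value_at_def
  proof (rule INF_greatest)
    fix p :: "('j, 'k, 'n) milp_point"
    assume "p \<in> {p \<in> milp_feasible I x R B b \<Gamma> M. encoded_queries I p = \<iota>}"
    then have p: "p \<in> milp_feasible I x R B b \<Gamma> M" and "\<iota> = encoded_queries I p"
      by auto
    then have "\<forall>u\<in>weak_response_set x B b \<Gamma> \<iota> s. \<forall>x'\<in>R. u \<bullet> (x' - rec p s) \<le> tau p"
      if "s \<in> strict_responses" for s
      using milp_weak_duality[OF p that] by blast
    moreover have rec: "rec p s \<in> R" if "s \<in> strict_responses" for s
      using p that by (auto simp: milp_feasible_def milp_domain_def)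
    \<comment> \<open>The constant pattern 1 is a strict response, so a feasible point supplies a
      recommendation.\<close>
    moreover have "R \<noteq> {}"
      using rec[of 1] by (auto simp: strict_responses_def)
    ultimately show "qp_value_at x R B b \<Gamma> \<iota> \<le> ereal (tau p)"
      by (subst le_iff) (auto intro!: bexI[of _ "rec p _"])
  qed
  show ?thesis
  proof (cases "R = {}")
    case True
    obtain s u where "u \<in> weak_response_set x B b \<Gamma> \<iota> s" "s \<in> strict_responses"
      using weak_response_set_nonempty[OF assms(4,2)] by blast
    then obtain s' where s': "s' \<in> responses x B b \<Gamma> \<iota>"
      using weak_response_set_dense[OF assms(4)] by blast
    \<comment> \<open>The inner infimum over the empty set is infinite, and the outer supremum
      includes it because some response is possible.\<close>
    have "top \<le> qp_value_at x R B b \<Gamma> \<iota>"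
      unfolding qp_value_at_def True by (rule SUP_upper2[OF s']) simp
    then show ?thesis
      using ge by (intro exI[of _ 0]) (metis order_antisym order_trans top_greatest)
  next
    case False
    obtain v where v: "qp_value_at x R B b \<Gamma> \<iota> = ereal v"
      using qp_value_at_real[OF assms(4,1) False assms(2,3)] by blast
    then have "qp_value_at x R B b \<Gamma> \<iota> \<le> ereal v"
      by simp
    then obtain m where m: "\<And>M. m \<le> M \<Longrightarrow> \<exists>p \<in> (milp_feasible I x R B b \<Gamma> M :: ('j, 'k, 'n) milp_point set).
        encoded_queries I p = \<iota> \<and> tau p = v"
      using milp_strong_duality[OF assms(1-3) \<iota>] unfolding le_iff[OF False] by metis
    have "milp_value_at I x R B b \<Gamma> M \<iota> \<le> ereal v" if "m \<le> M" for M
      using m[OF that] unfolding milp_value_at_def by (auto intro!: INF_lower2)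
    then show ?thesis
      using ge v by (metis order_antisym)
  qed
qed

theorem theorem5:
  fixes I :: nat
    and x :: "nat \<Rightarrow> real^'j"
    and R :: "(real^'j) set"
    and B :: "real^'j^'n"
    and b :: "real^'n"
    and \<Gamma> :: real
  assumes "I \<ge> 2"
    and "finite R"
    and "initial_set B b \<noteq> {}"
    and "aff_dim (initial_set B b) = int CARD('j)"
    and "bounded (initial_set B b)"
    and "\<Gamma> \<ge> 0"
  shows "\<exists>M0::real. \<forall>M\<ge>M0.
    qp_value TYPE('k::finite) I x R B b \<Gamma> = milp_value TYPE('k) I x R B b \<Gamma> M \<and>
    (qp_optimal_queries I x R B b \<Gamma> :: ((nat \<times> nat)^'k) set)
      = milp_optimal_queries I x R B b \<Gamma> M \<and>
    (\<forall>p \<in> (milp_optimal_solutions I x R B b \<Gamma> M :: ('j, 'k, 'n) milp_point set).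
       encoded_queries I p \<in> qp_optimal_queries I x R B b \<Gamma>)"
proof -
  let ?Q = "query_sets I :: ((nat \<times> nat)^'k) set"
  have "\<forall>\<iota>\<in>?Q. \<exists>m. \<forall>M\<ge>m. milp_value_at I x R B b \<Gamma> M \<iota> = qp_value_at x R B b \<Gamma> \<iota>"
    using milp_value_at_eq_qp_value_at[OF assms(2,3,5,6)] by blast
  then obtain m where m: "\<And>\<iota> M. \<iota> \<in> ?Q \<Longrightarrow> m \<iota> \<le> M \<Longrightarrow>
      milp_value_at I x R B b \<Gamma> M \<iota> = qp_value_at x R B b \<Gamma> \<iota>"
    by metis
  \<comment> \<open>There are finitely many query sets, so their thresholds have a common upper
    bound.\<close>
  obtain M0 where M0: "\<And>\<iota>. \<iota> \<in> ?Q \<Longrightarrow> m \<iota> \<le> M0"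
    using bdd_above_finite[OF finite_imageI[OF finite_query_sets, of m I]] unfolding bdd_above_def
    by blast
  show ?thesis
  proof (intro exI allI impI)
    fix M
    assume "M0 \<le> M"
    then have eq: "milp_value_at I x R B b \<Gamma> M \<iota> = qp_value_at x R B b \<Gamma> \<iota>" if "\<iota> \<in> ?Q" for \<iota>
      using m[OF that] M0[OF that] by simp
    let ?F = "milp_feasible I x R B b \<Gamma> M :: ('j, 'k, 'n) milp_point set"
    have enc: "encoded_queries I p \<in> ?Q" if "p \<in> ?F" for p
      using that by (rule encoded_queries_selection)
    \<comment> \<open>The feasible points are partitioned by the queries that they encode, all of
      which lie in \<open>?Q\<close>.\<close>
    have "milp_value TYPE('k) I x R B b \<Gamma> M = (INF \<iota>\<in>?Q. milp_value_at I x R B b \<Gamma> M \<iota>)"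
      unfolding milp_value_def milp_value_at_def
      by (intro antisym INF_greatest) (auto intro: INF_lower INF_lower2[OF enc])
    then have val: "qp_value TYPE('k) I x R B b \<Gamma> = milp_value TYPE('k) I x R B b \<Gamma> M"
      by (simp add: qp_value_def eq)
    then have opt: "(qp_optimal_queries I x R B b \<Gamma> :: ((nat \<times> nat)^'k) set)
        = milp_optimal_queries I x R B b \<Gamma> M"
      by (auto simp: qp_optimal_queries_def milp_optimal_queries_def eq)
    have "encoded_queries I p \<in> milp_optimal_queries I x R B b \<Gamma> M"
      if p: "p \<in> (milp_optimal_solutions I x R B b \<Gamma> M :: ('j, 'k, 'n) milp_point set)" for p
    proof -
      have pF: "p \<in> ?F" and least: "\<And>q. q \<in> ?F \<Longrightarrow> tau p \<le> tau q"
        using p by (auto simp: milp_optimal_solutions_def)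
      have "milp_value_at I x R B b \<Gamma> M (encoded_queries I p) = ereal (tau p)"
        unfolding milp_value_at_def
        by (rule antisym) (use pF least in \<open>auto intro: INF_lower INF_greatest\<close>)
      moreover have "milp_value TYPE('k) I x R B b \<Gamma> M = ereal (tau p)"
        unfolding milp_value_def
        by (rule antisym) (use pF least in \<open>auto intro: INF_lower INF_greatest\<close>)
      ultimately show ?thesis
        using enc[OF pF] by (simp add: milp_optimal_queries_def)
    qed
    then show "qp_value TYPE('k) I x R B b \<Gamma> = milp_value TYPE('k) I x R B b \<Gamma> M \<and>
      (qp_optimal_queries I x R B b \<Gamma> :: ((nat \<times> nat)^'k) set)
        = milp_optimal_queries I x R B b \<Gamma> M \<and>
      (\<forall>p \<in> (milp_optimal_solutions I x R B b \<Gamma> M :: ('j, 'k, 'n) milp_point set).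
         encoded_queries I p \<in> qp_optimal_queries I x R B b \<Gamma>)"
      using val opt by simp
  qed
qed

end
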